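(* Let $H$ be a real Hilbert space and let $A$ be a nonnegative self-adjoint linear operator on $H$ that is an unbounded positive multiplication operator. Let $T_0>0$ and $\mu_2>\mu_1>0$ be real numbers, and let $\omega:(0,T_0]\to(0,+\infty)$ be a nonincreasing function such that $$\lim_{t\to 0^+}\omega(t)=+\infty.$$ Let $\mathcal{PS}^{(1)}(T_0,\mu_1,\mu_2,\omega)$ be the set of propagation speeds defined in the context, with the structure of complete metric space induced by the distance $d_{\mathcal{PS}^{(1)}}$ defined there. Then the set of propagation speeds $c\in\mathcal{PS}^{(1)}(T_0,\mu_1,\mu_2,\omega)$ for which the problem $$u''(t)+c(t)Au(t)=0,\qquad u(0)=u_0,\quad u'(0)=u_1,$$ on $[0,T_0]$ exhibits an infinite derivative loss is residual in $\mathcal{PS}^{(1)}(T_0,\mu_1,\mu_2,\omega)$.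
   Context: Unbounded positive multiplication operator. $A$ is an unbounded positive multiplication operator if there exist a sequence $\{e_n\}\subseteq H$ of orthonormal vectors (not necessarily a Hilbert basis) and an unbounded sequence $\{\lambda_n\}$ of positive real numbers such that $Ae_n=\lambda_ne_n$ for every $n\geq 1$. Propagation speeds. $\mathcal{PS}^{(1)}(T_0,\mu_1,\mu_2,\omega)$ is the set of functions $c\in C^0([0,T_0])\cap C^1((0,T_0])$ such that $\mu_1\leq c(t)\leq\mu_2$ for every $t\in(0,T_0)$ and $|c'(t)|\leq\omega(t)/t$ for every $t\in(0,T_0]$. It is a complete metric space with the distance $$d_{\mathcal{PS}^{(1)}}(c_1,c_2):=\sup_{t\in(0,T_0)}|c_1(t)-c_2(t)|+\sup_{t\in(0,T_0)}\left\{\frac{t^2}{\omega(t)}|c_1'(t)-c_2'(t)|\right\}.$$ A subset of a metric space is residual if its complement is contained in a countable union of closed sets with empty interior. Scale of spaces. By the spectral theorem, $A$ is unitarily equivalent to multiplication by a nonnegative measurable function $a(\xi)$ on some space $L^2(X,\mu)$. For every real $\beta$ (also negative), $D(A^\beta)$ denotes the space of (classes of) measurable functions $v$ on $X$ with $(1+a)^\beta v\in L^2(X,\mu)$. Solutions. A (possibly very weak) solution is defined componentwise: for a.e. $\xi\in X$, $t\mapsto u(t,\xi)$ solves $u''(t,\xi)+c(t)a(\xi)u(t,\xi)=0$ on $[0,T_0]$, with initial data $u(0,\xi)=u_0(\xi)$, $u'(0,\xi)=u_1(\xi)$, where $u_0,u_1$ are measurable functions on $X$. Infinite derivative loss. The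 problem exhibits an infinite derivative loss if there exists a solution $u(t)$ such that $(u(0),u'(0))\in D(A^{\beta+1/2})\times D(A^\beta)$ for every $\beta>0$, but $(u(t),u'(t))\notin D(A^{-\beta+1/2})\times D(A^{-\beta})$ for every $\beta>0$ and every $t\in(0,T_0]$. *)

theory Defs
  imports "HOL-Analysis.Analysis"
begin

subsection \<open>Unbounded operators\<close>

text \<open>
  An operator on a real Hilbert space is a domain \<^term>\<open>D\<close> together with a total function
  \<^term>\<open>A\<close> whose values outside \<^term>\<open>D\<close> are irrelevant.
\<close>

definition linear_operator :: "'h::real_inner set \<Rightarrow> ('h \<Rightarrow> 'h) \<Rightarrow> bool" where
  "linear_operator D A \<longleftrightarrow> subspace D \<and>
     (\<forall>x\<in>D. \<forall>y\<in>D. A (x + y) = A x + A y) \<and> (\<forall>r. \<forall>x\<in>D. A (r *\<^sub>R x) = r *\<^sub>R A x)"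

definition adjoint_graph :: "'h::real_inner set \<Rightarrow> ('h \<Rightarrow> 'h) \<Rightarrow> ('h \<times> 'h) set" where
  "adjoint_graph D A = {(y, z). \<forall>x\<in>D. A x \<bullet> y = x \<bullet> z}"

definition self_adjoint :: "'h::real_inner set \<Rightarrow> ('h \<Rightarrow> 'h) \<Rightarrow> bool" where
  "self_adjoint D A \<longleftrightarrow> linear_operator D A \<and> closure D = UNIV \<and>
     adjoint_graph D A = {(y, z). y \<in> D \<and> z = A y}"

definition nonnegative_operator :: "'h::real_inner set \<Rightarrow> ('h \<Rightarrow> 'h) \<Rightarrow> bool" where
  "nonnegative_operator D A \<longleftrightarrow> (\<forall>x\<in>D. 0 \<le> A x \<bullet> x)"

definition unbounded_positive_multiplication_operator ::
    "'h::real_inner set \<Rightarrow> ('h \<Rightarrow> 'h) \<Rightarrow> bool" where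
  "unbounded_positive_multiplication_operator D A \<longleftrightarrow>
     (\<exists>(e :: nat \<Rightarrow> 'h) (l :: nat \<Rightarrow> real).
        (\<forall>m n. e m \<bullet> e n = (if m = n then 1 else 0)) \<and>
        (\<forall>n. 0 < l n) \<and> \<not> bdd_above (range l) \<and>
        (\<forall>n. e n \<in> D \<and> A (e n) = l n *\<^sub>R e n))"

subsection \<open>Spectral representation and scale of spaces\<close>

definition L2 :: "'x measure \<Rightarrow> ('x \<Rightarrow> real) set" where
  "L2 M = {f \<in> borel_measurable M. integrable M (\<lambda>x. (f x)\<^sup>2)}"

text \<open>
  \<^term>\<open>U\<close> is a unitary map from the Hilbert space onto the square integrable functions modulo null
  functions, and it carries the operator, domain included, to multiplication by \<^term>\<open>a\<close>.
\<close>

definition spectral_representation ::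
    "'h::real_inner set \<Rightarrow> ('h \<Rightarrow> 'h) \<Rightarrow> 'x measure \<Rightarrow> ('x \<Rightarrow> real) \<Rightarrow> ('h \<Rightarrow> 'x \<Rightarrow> real) \<Rightarrow> bool" where
  "spectral_representation D A M a U \<longleftrightarrow>
     a \<in> borel_measurable M \<and> (\<forall>x\<in>space M. 0 \<le> a x) \<and>
     (\<forall>h. U h \<in> L2 M) \<and>
     (\<forall>h k. AE x in M. U (h + k) x = U h x + U k x) \<and>
     (\<forall>r h. AE x in M. U (r *\<^sub>R h) x = r * U h x) \<and>
     (\<forall>h. (\<integral>x. (U h x)\<^sup>2 \<partial>M) = (norm h)\<^sup>2) \<and>
     (\<forall>f\<in>L2 M. \<exists>h. AE x in M. U h x = f x) \<and>
     (\<forall>h. h \<in> D \<longleftrightarrow> (\<lambda>x. a x * U h x) \<in> L2 M) \<and>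
     (\<forall>h\<in>D. AE x in M. U (A h) x = a x * U h x)"

text \<open>
  The elements of \<open>D(A\<^sup>\<beta>)\<close> are classes of measurable functions, so membership of a concrete
  function is tested up to equality almost everywhere. Without this, a solution could be pushed out
  of every space by making it nonmeasurable on a null set.
\<close>

definition dom_power :: "'x measure \<Rightarrow> ('x \<Rightarrow> real) \<Rightarrow> real \<Rightarrow> ('x \<Rightarrow> real) set" where
  "dom_power M a \<beta> = {v. \<exists>w \<in> borel_measurable M.
     (AE x in M. v x = w x) \<and> (\<lambda>x. (1 + a x) powr \<beta> * w x) \<in> L2 M}"

subsection \<open>Solutions and derivative loss\<close>

text \<open>\<^term>\<open>v\<close> plays the role of \<open>u'\<close>; derivatives are one-sided at the endpoints.\<close>

definition solves_wave_equation ::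
    "'x measure \<Rightarrow> ('x \<Rightarrow> real) \<Rightarrow> real \<Rightarrow> (real \<Rightarrow> real) \<Rightarrow> ('x \<Rightarrow> real) \<Rightarrow> ('x \<Rightarrow> real) \<Rightarrow>
     (real \<Rightarrow> 'x \<Rightarrow> real) \<Rightarrow> (real \<Rightarrow> 'x \<Rightarrow> real) \<Rightarrow> bool" where
  "solves_wave_equation M a T0 c u0 u1 u v \<longleftrightarrow>
     u0 \<in> borel_measurable M \<and> u1 \<in> borel_measurable M \<and>
     (AE x in M.
        (\<forall>t\<in>{0..T0}.
           ((\<lambda>s. u s x) has_real_derivative v t x) (at t within {0..T0}) \<and>
           ((\<lambda>s. v s x) has_real_derivative - (c t * a x * u t x)) (at t within {0..T0})) \<and>
        u 0 x = u0 x \<and> v 0 x = u1 x)"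

definition infinite_derivative_loss ::
    "'x measure \<Rightarrow> ('x \<Rightarrow> real) \<Rightarrow> real \<Rightarrow> (real \<Rightarrow> real) \<Rightarrow> bool" where
  "infinite_derivative_loss M a T0 c \<longleftrightarrow>
     (\<exists>u0 u1 u v. solves_wave_equation M a T0 c u0 u1 u v \<and>
        (\<forall>\<beta>>0. (u 0, v 0) \<in> dom_power M a (\<beta> + 1/2) \<times> dom_power M a \<beta>) \<and>
        (\<forall>\<beta>>0. \<forall>t\<in>{0<..T0}.
           (u t, v t) \<notin> dom_power M a (- \<beta> + 1/2) \<times> dom_power M a (- \<beta>)))"

subsection \<open>Propagation speeds\<close>

definition speed_deriv :: "real \<Rightarrow> (real \<Rightarrow> real) \<Rightarrow> real \<Rightarrow> real" where
  "speed_deriv T0 c t = vector_derivative c (at t within {0<..T0})"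

text \<open>
  Functions on \<open>[0, T0]\<close> are represented by their extensional versions on \<^typ>\<open>real\<close>, so that
  the distance separates points.
\<close>

definition PS1 :: "real \<Rightarrow> real \<Rightarrow> real \<Rightarrow> (real \<Rightarrow> real) \<Rightarrow> (real \<Rightarrow> real) set" where
  "PS1 T0 \<mu>1 \<mu>2 \<omega> = {c \<in> extensional {0..T0}.
     continuous_on {0..T0} c \<and>
     c differentiable_on {0<..T0} \<and> continuous_on {0<..T0} (speed_deriv T0 c) \<and>
     (\<forall>t\<in>{0<..<T0}. \<mu>1 \<le> c t \<and> c t \<le> \<mu>2) \<and>
     (\<forall>t\<in>{0<..T0}. \<bar>speed_deriv T0 c t\<bar> \<le> \<omega> t / t)}"

text \<open>
  The locale \<^locale>\<open>Metric_space\<close> demands nonnegativity and symmetry for all arguments, not only for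
  those in the carrier, whence the default value \<open>0\<close> off the carrier.
\<close>

definition dist_PS1 ::
    "real \<Rightarrow> real \<Rightarrow> real \<Rightarrow> (real \<Rightarrow> real) \<Rightarrow> (real \<Rightarrow> real) \<Rightarrow> (real \<Rightarrow> real) \<Rightarrow> real" where
  "dist_PS1 T0 \<mu>1 \<mu>2 \<omega> c1 c2 =
     (if c1 \<in> PS1 T0 \<mu>1 \<mu>2 \<omega> \<and> c2 \<in> PS1 T0 \<mu>1 \<mu>2 \<omega> then
        (SUP t\<in>{0<..<T0}. \<bar>c1 t - c2 t\<bar>) +
        (SUP t\<in>{0<..<T0}. t\<^sup>2 / \<omega> t * \<bar>speed_deriv T0 c1 t - speed_deriv T0 c2 t\<bar>)
      else 0)"

definition residual_in :: "'a topology \<Rightarrow> 'a set \<Rightarrow> bool" where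
  "residual_in X R \<longleftrightarrow> R \<subseteq> topspace X \<and>
     (\<exists>\<C>. countable \<C> \<and> (\<forall>C\<in>\<C>. closedin X C \<and> X interior_of C = {}) \<and>
          topspace X - R \<subseteq> \<Union>\<C>)"

lemma Metric_space_PS1:
  fixes T0 \<mu>1 \<mu>2 :: real and \<omega> :: "real \<Rightarrow> real"
  assumes T0: "0 < T0" and pos: "\<And>t. t \<in> {0<..T0} \<Longrightarrow> 0 < \<omega> t"
  shows "Metric_space (PS1 T0 \<mu>1 \<mu>2 \<omega>) (dist_PS1 T0 \<mu>1 \<mu>2 \<omega>)"
proof -
  let ?I = "{0<..<T0}" and ?P = "PS1 T0 \<mu>1 \<mu>2 \<omega>"
  let ?f = "\<lambda>c1 c2 t. \<bar>c1 t - c2 t :: real\<bar>"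
  let ?g = "\<lambda>c1 c2 t. t\<^sup>2 / \<omega> t * \<bar>speed_deriv T0 c1 t - speed_deriv T0 c2 t\<bar>"
  have ne: "?I \<noteq> {}" using T0 by simp
  have bf: "bdd_above (?f c1 c2 ` ?I)" if "c1 \<in> ?P" "c2 \<in> ?P" for c1 c2
  proof (rule bdd_aboveI2)
    fix t assume "t \<in> ?I"
    with that have "\<mu>1 \<le> c1 t" "c1 t \<le> \<mu>2" "\<mu>1 \<le> c2 t" "c2 t \<le> \<mu>2" by (auto simp: PS1_def)
    then show "?f c1 c2 t \<le> \<mu>2 - \<mu>1" by linarith
  qed
  have bg: "bdd_above (?g c1 c2 ` ?I)" if "c1 \<in> ?P" "c2 \<in> ?P" for c1 c2
  proof (rule bdd_aboveI2)
    fix t assume t: "t \<in> ?I"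
    with that have "\<bar>speed_deriv T0 c1 t\<bar> \<le> \<omega> t / t" "\<bar>speed_deriv T0 c2 t\<bar> \<le> \<omega> t / t"
      by (auto simp: PS1_def)
    then have 1: "\<bar>speed_deriv T0 c1 t - speed_deriv T0 c2 t\<bar> \<le> 2 * (\<omega> t / t)" by linarith
    have w: "0 < \<omega> t" using t pos by simp
    have "?g c1 c2 t \<le> t\<^sup>2 / \<omega> t * (2 * (\<omega> t / t))"
      by (rule mult_left_mono[OF 1]) (use w in simp)
    also have "\<dots> = 2 * t" using w t by (simp add: power2_eq_square)
    also have "\<dots> \<le> 2 * T0" using t by simp
    finally show "?g c1 c2 t \<le> 2 * T0" .
  qed
  have gnn: "0 \<le> ?g c1 c2 t" if "t \<in> ?I" for c1 c2 t
    using that pos[of t] by simp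
  have sf: "0 \<le> (SUP t\<in>?I. ?f c1 c2 t)" if "c1 \<in> ?P" "c2 \<in> ?P" for c1 c2
    by (rule order_trans[OF _ cSUP_upper[OF _ bf[OF that], of "T0/2"]]) (use T0 in auto)
  have sg: "0 \<le> (SUP t\<in>?I. ?g c1 c2 t)" if "c1 \<in> ?P" "c2 \<in> ?P" for c1 c2
    by (rule order_trans[OF _ cSUP_upper[OF _ bg[OF that], of "T0/2"]]) (use T0 gnn in auto)
  have comm: "dist_PS1 T0 \<mu>1 \<mu>2 \<omega> c1 c2 = dist_PS1 T0 \<mu>1 \<mu>2 \<omega> c2 c1" for c1 c2
    by (auto simp: dist_PS1_def abs_minus_commute)
  have nonneg: "0 \<le> dist_PS1 T0 \<mu>1 \<mu>2 \<omega> c1 c2" if "c1 \<in> ?P" "c2 \<in> ?P" for c1 c2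
    using that sf[OF that] sg[OF that] by (simp add: dist_PS1_def)
  have zero: "dist_PS1 T0 \<mu>1 \<mu>2 \<omega> c1 c2 = 0 \<longleftrightarrow> c1 = c2" if P: "c1 \<in> ?P" "c2 \<in> ?P" for c1 c2
  proof
    assume "dist_PS1 T0 \<mu>1 \<mu>2 \<omega> c1 c2 = 0"
    then have "(SUP t\<in>?I. ?f c1 c2 t) = 0"
      using P sf[OF P] sg[OF P] by (simp add: dist_PS1_def)
    then have z: "c1 t - c2 t = 0" if "t \<in> ?I" for t
      using cSUP_upper[OF that bf[OF P]] by simp
    have "continuous_on (closure ?I) (\<lambda>t. c1 t - c2 t)"
      using P T0 by (auto simp: PS1_def intro!: continuous_intros)
    then have "c1 t - c2 t = 0" if "t \<in> {0..T0}" for t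
      by (rule continuous_constant_on_closure) (use z that T0 in auto)
    then show "c1 = c2"
      using P by (intro extensionalityI[of _ "{0..T0}"]) (auto simp: PS1_def)
  next
    assume "c1 = c2" then show "dist_PS1 T0 \<mu>1 \<mu>2 \<omega> c1 c2 = 0"
      using ne by (simp add: dist_PS1_def)
  qed
  have tri: "dist_PS1 T0 \<mu>1 \<mu>2 \<omega> c1 c3 \<le> dist_PS1 T0 \<mu>1 \<mu>2 \<omega> c1 c2 + dist_PS1 T0 \<mu>1 \<mu>2 \<omega> c2 c3"
    if P: "c1 \<in> ?P" "c2 \<in> ?P" "c3 \<in> ?P" for c1 c2 c3
  proof -
    have "(SUP t\<in>?I. ?f c1 c3 t) \<le> (SUP t\<in>?I. ?f c1 c2 t) + (SUP t\<in>?I. ?f c2 c3 t)"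
    proof (rule cSUP_least[OF ne])
      fix t assume t: "t \<in> ?I"
      show "?f c1 c3 t \<le> (SUP t\<in>?I. ?f c1 c2 t) + (SUP t\<in>?I. ?f c2 c3 t)"
        using cSUP_upper[OF t bf[OF P(1,2)]] cSUP_upper[OF t bf[OF P(2,3)]] by linarith
    qed
    moreover have "(SUP t\<in>?I. ?g c1 c3 t) \<le> (SUP t\<in>?I. ?g c1 c2 t) + (SUP t\<in>?I. ?g c2 c3 t)"
    proof (rule cSUP_least[OF ne])
      fix t assume t: "t \<in> ?I"
      have "?g c1 c3 t \<le> t\<^sup>2 / \<omega> t * (\<bar>speed_deriv T0 c1 t - speed_deriv T0 c2 t\<bar> +
              \<bar>speed_deriv T0 c2 t - speed_deriv T0 c3 t\<bar>)"
        by (rule mult_left_mono) (use t pos[of t] in auto)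
      also have "\<dots> = ?g c1 c2 t + ?g c2 c3 t" by (simp add: distrib_left)
      finally show "?g c1 c3 t \<le> (SUP t\<in>?I. ?g c1 c2 t) + (SUP t\<in>?I. ?g c2 c3 t)"
        using cSUP_upper[OF t bg[OF P(1,2)]] cSUP_upper[OF t bg[OF P(2,3)]] by linarith
    qed
    ultimately show ?thesis using P by (simp add: dist_PS1_def)
  qed
  show ?thesis
  proof
    fix c1 c2 show "0 \<le> dist_PS1 T0 \<mu>1 \<mu>2 \<omega> c1 c2"
      by (cases "c1 \<in> ?P \<and> c2 \<in> ?P") (auto simp: nonneg, auto simp: dist_PS1_def)
  qed (use comm zero tri in auto)
qed

end

theory Submission
  imports Defs
begin

text \<open>
  The operator acts diagonally, so everything happens one frequency at a time: at an eigenvalue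
  \<open>\<lambda>\<close> the equation is the scalar oscillator \<open>w'' + \<lambda> c(t) w = 0\<close>. Infinite loss of
  derivatives follows once, along eigenvalues \<open>\<lambda>\<^sub>k \<rightarrow> \<infinity>\<close>, the oscillator started from
  \<open>w(0) = 0\<close>, \<open>w'(0) = 1\<close> reaches by time \<open>1/(k+1)\<close>, and keeps afterwards, an energy larger than
  \<open>\<lambda>\<^sub>k\<^sup>4\<^sup>k\<close>. Putting the data \<open>\<lambda>\<^sub>k\<^sup>-\<^sup>k\<close> times a normalised eigenfunction on each of these
  frequencies gives initial data smaller than every power of the frequency, and a solution larger
  than every power of the frequency at each positive time
  (\<open>infinite_derivative_loss_if_amplifying\<close>).

  Call \<open>G\<^sub>m\<close> the set of speeds having one eigenvalue \<open>\<lambda> > m + 2\<close> whose mode has energy above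
  \<open>\<lambda>\<^sup>4\<^sup>m\<close> on \<open>[1/(m+1), T\<^sub>0]\<close>. Every speed in all the \<open>G\<^sub>m\<close> has an infinite derivative loss, so the
  claim is that each \<open>G\<^sub>m\<close> is open and dense. Openness is continuous dependence of a single
  oscillator on its coefficient in the uniform norm (\<open>open_amplifying\<close>).

  Density (\<open>dense_amplifying\<close>) is parametric resonance. Near \<open>t = 0\<close> the weight \<open>t\<^sup>2/\<omega>(t)\<close>
  in the distance makes changes of the derivative harmless as long as the bound
  \<open>\<bar>c'\<bar> \<le> \<omega>(t)/t\<close> is respected, so on a short interval \<open>[0, \<rho>]\<close> a speed can be replaced by its value
  at \<open>0\<close>, and then be made to oscillate in tune with the frequency \<open>\<gamma> = sqrt (\<lambda> c(0))\<close>. An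
  oscillation whose derivative is of order \<open>K/t\<close> raises the logarithm of the energy by about
  \<open>\<integral> K/t dt\<close>; it can be kept up from \<open>t \<approx> 1/\<gamma>\<close> to \<open>t \<approx> \<rho>\<close>, and so gains a factor
  \<open>\<lambda>\<^sup>K\<^sup>/\<^sup>2\<close> up to constants. Since \<open>\<omega>\<close> is unbounded near \<open>0\<close>, any \<open>K\<close> is admissible once
  \<open>\<rho>\<close> is small. After \<open>\<rho>\<close> the speed has a derivative bounded independently of \<open>\<lambda>\<close>, so only a
  constant factor of the energy can be lost again (\<open>energy_lower_bound\<close>).
\<close>

section \<open>The oscillator at a single frequency\<close>

text \<open>
  The initial data \<open>(0, 1)\<close> are the same for every frequency, so one solution per frequency has to
  be followed.
\<close>

definition wave_mode :: "real \<Rightarrow> (real \<Rightarrow> real) \<Rightarrow> real \<Rightarrow> (real \<Rightarrow> real) \<Rightarrow> (real \<Rightarrow> real) \<Rightarrow> bool" where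
  "wave_mode T c lam w v \<longleftrightarrow> w 0 = 0 \<and> v 0 = 1 \<and>
     (\<forall>t\<in>{0..T}. (w has_real_derivative v t) (at t within {0..T}) \<and>
        (v has_real_derivative - (c t * lam * w t)) (at t within {0..T}))"

text \<open>
  Integrating twice turns the problem into the Volterra equation
  \<open>w(s) = s - \<integral>\<^sub>0\<^sup>s (s - r) q(r) w(r) dr\<close>. In terms of \<open>g(s) = exp (- K s) w(s)\<close> its right-hand side
  contracts the uniform distance by a factor \<open>T B / K\<close>, which the choice of \<open>K\<close> makes at most \<open>1/2\<close>,
  so the Banach fixed point theorem applies. Times are clamped to \<open>[0, T]\<close> in order to work with
  bounded continuous functions on the whole line.
\<close>

lemma continuous_linear_wave_exists:
  fixes T :: real and q :: "real \<Rightarrow> real"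
  assumes T: "0 < T" and q: "continuous_on UNIV q" and B: "\<And>t. \<bar>q t\<bar> \<le> B"
  shows "\<exists>w v. wave_mode T q 1 w v"
proof -
  define K where "K = 2 * T * B + 1"
  have B0: "0 \<le> B" using B[of 0] by linarith
  then have K: "K > 0" "T * B \<le> K / 2" using T by (auto simp: K_def add_nonneg_pos)
  define cl where "cl t = max 0 (min T t)" for t
  have cl: "0 \<le> cl t" "cl t \<le> T" for t using T by (auto simp: cl_def)
  have ccl: "continuous_on UNIV cl" unfolding cl_def by (intro continuous_intros)
  define f where "f g r = q r * (exp (K * r) * apply_bcontfun g r)" for g :: "real \<Rightarrow>\<^sub>C real" and r
  have cf: "continuous_on S (f g)" for g S
    unfolding f_def by (intro continuous_intros continuous_on_subset[OF q]) auto
  have fi: "f g integrable_on {a..b}" "(\<lambda>r. r * f g r) integrable_on {a..b}"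
    "(\<lambda>r. s * f g r) integrable_on {a..b}" for g a b s
    by (auto intro!: integrable_continuous_real continuous_intros cf)
  define W where "W g s = s - s * integral {0..s} (f g) + integral {0..s} (\<lambda>r. r * f g r)" for g s
  have dI: "((\<lambda>s. integral {0..s} (f g)) has_real_derivative f g s) (at s within {0..T})"
     "((\<lambda>s. integral {0..s} (\<lambda>r. r * f g r)) has_real_derivative s * f g s) (at s within {0..T})"
    if "s \<in> {0..T}" for g s
    using that by (auto intro!: integral_has_real_derivative continuous_intros cf)
  have dW: "(W g has_real_derivative 1 - integral {0..s} (f g)) (at s within {0..T})"
    if "s \<in> {0..T}" for g s
    unfolding W_def using that
    by (auto intro!: derivative_eq_intros dI simp: algebra_simps)
  have cW: "continuous_on {0..T} (W g)" for g
    using dW by (meson DERIV_continuous continuous_on_eq_continuous_within)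
  define \<Phi> where "\<Phi> g t = exp (- K * cl t) * W g (cl t)" for g t
  have bc: "\<Phi> g \<in> bcontfun" for g
  proof -
    have c1: "continuous_on {0..T} (\<lambda>s. exp (- K * s) * W g s)"
      by (intro continuous_intros cW)
    then have "bounded ((\<lambda>s. exp (- K * s) * W g s) ` {0..T})"
      by (intro compact_imp_bounded compact_continuous_image) auto
    moreover have "range (\<Phi> g) \<subseteq> (\<lambda>s. exp (- K * s) * W g s) ` {0..T}"
      using cl by (auto simp: \<Phi>_def)
    ultimately have "bounded (range (\<Phi> g))" by (rule bounded_subset)
    moreover have "continuous_on UNIV (\<lambda>t. exp (- K * cl t) * W g (cl t))"
      by (rule continuous_on_compose2[OF c1 ccl]) (use cl in auto)
    ultimately show ?thesis by (simp add: bcontfun_def \<Phi>_def)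
  qed
  define F where "F g = Bcontfun (\<Phi> g)" for g
  have F: "apply_bcontfun (F g) = \<Phi> g" for g
    unfolding F_def by (rule Bcontfun_inverse[OF bc])
  have contr: "dist (F g) (F h) \<le> 1/2 * dist g h" for g h
  proof (rule dist_bound)
    fix t
    let ?s = "cl t" and ?d = "dist g h"
    have d: "\<bar>apply_bcontfun g r - apply_bcontfun h r\<bar> \<le> ?d" for r
      using dist_bounded[of g r h] by (simp add: dist_real_def)
    have "W g ?s - W h ?s = integral {0..?s} (\<lambda>r. (r - ?s) * (f g r - f h r))"
    proof -
      have "integral {0..?s} (\<lambda>r. (r - ?s) * (f g r - f h r)) =
        integral {0..?s} (\<lambda>r. (r * f g r - r * f h r) - (?s * f g r - ?s * f h r))"
        by (simp add: algebra_simps)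
      also have "\<dots> = integral {0..?s} (\<lambda>r. r * f g r) - integral {0..?s} (\<lambda>r. r * f h r)
         - (?s * integral {0..?s} (f g) - ?s * integral {0..?s} (f h))"
        by (simp add: fi Henstock_Kurzweil_Integration.integral_diff Henstock_Kurzweil_Integration.integrable_diff)
      finally show ?thesis by (simp add: W_def)
    qed
    also have "norm \<dots> \<le> integral {0..?s} (\<lambda>r. (T * B * ?d) * exp (K * r))"
    proof (rule Henstock_Kurzweil_Integration.integral_norm_bound_integral)
      show "(\<lambda>r. (r - ?s) * (f g r - f h r)) integrable_on {0..?s}"
        by (auto intro!: integrable_continuous_real continuous_intros cf)
      show "(\<lambda>r. (T * B * ?d) * exp (K * r)) integrable_on {0..?s}"
        by (auto intro!: integrable_continuous_real continuous_intros)
      fix r assume r: "r \<in> {0..?s}"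
      have "\<bar>(r - ?s) * (f g r - f h r)\<bar> =
         \<bar>r - ?s\<bar> * (\<bar>q r\<bar> * (exp (K*r) * \<bar>apply_bcontfun g r - apply_bcontfun h r\<bar>))"
        by (simp add: f_def abs_mult right_diff_distrib[symmetric])
      also have "\<dots> \<le> T * (B * (exp (K*r) * ?d))"
        using r cl[of t] T B0 by (intro mult_mono B d) auto
      finally show "norm ((r - ?s) * (f g r - f h r)) \<le> T * B * ?d * exp (K * r)"
        by (simp add: mult_ac)
    qed
    also have "\<dots> = T * B * ?d * (exp (K * ?s) / K - 1 / K)"
    proof -
      have "((\<lambda>r. exp (K * r)) has_integral exp (K * ?s) / K - exp (K * 0) / K) {0..?s}"
        by (rule fundamental_theorem_of_calculus)
          (use cl K in \<open>auto intro!: derivative_eq_intros simp flip: has_real_derivative_iff_has_vector_derivative\<close>)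
      then show ?thesis by (simp add: integral_unique)
    qed
    also have "\<dots> \<le> (T * B / K) * ?d * exp (K * ?s)"
      using K T B0 by (simp add: field_simps mult_left_mono)
    finally have *: "\<bar>W g ?s - W h ?s\<bar> \<le> (T * B / K) * ?d * exp (K * ?s)" by simp
    have "dist (apply_bcontfun (F g) t) (apply_bcontfun (F h) t) = exp (- K * ?s) * \<bar>W g ?s - W h ?s\<bar>"
      by (simp add: F \<Phi>_def dist_real_def abs_mult flip: right_diff_distrib)
    also have "\<dots> \<le> exp (- K * ?s) * ((T * B / K) * ?d * exp (K * ?s))"
      by (intro mult_left_mono *) auto
    also have "\<dots> = (T * B / K) * ?d" by (simp add: exp_minus)
    also have "\<dots> \<le> 1/2 * ?d" using K by (intro mult_right_mono) (auto simp: field_simps)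
    finally show "dist (apply_bcontfun (F g) t) (apply_bcontfun (F h) t) \<le> 1/2 * ?d" .
  qed
  obtain g where g: "F g = g"
    using banach_fix_type[of "1/2" F] contr by auto
  have gW: "exp (K * s) * apply_bcontfun g s = W g s" if "s \<in> {0..T}" for s
  proof -
    have "apply_bcontfun g s = \<Phi> g s" using F[of g] g by simp
    moreover have "cl s = s" using that by (auto simp: cl_def)
    ultimately show ?thesis by (simp add: \<Phi>_def exp_minus)
  qed
  have "wave_mode T q 1 (W g) (\<lambda>s. 1 - integral {0..s} (f g))"
    unfolding wave_mode_def
  proof (intro conjI ballI)
    fix s assume s: "s \<in> {0..T}"
    show "(W g has_real_derivative 1 - integral {0..s} (f g)) (at s within {0..T})" by (rule dW[OF s])
    have "f g s = q s * 1 * W g s" using gW[OF s] by (simp add: f_def)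
    then show "((\<lambda>s. 1 - integral {0..s} (f g)) has_real_derivative - (q s * 1 * W g s)) (at s within {0..T})"
      using s by (auto intro!: derivative_eq_intros dI)
  qed (auto simp: W_def)
  then show ?thesis by blast
qed

lemma wave_mode_exists:
  assumes T: "0 < T" and c: "continuous_on {0..T} c"
  shows "\<exists>w v. wave_mode T c lam w v"
proof -
  define cl where "cl t = max 0 (min T t)" for t
  have ccl: "continuous_on UNIV cl" unfolding cl_def by (intro continuous_intros)
  have cl: "cl t \<in> {0..T}" for t using T by (auto simp: cl_def)
  define q where "q t = c (cl t) * lam" for t
  have "bounded (c ` {0..T})" by (intro compact_imp_bounded compact_continuous_image c) auto
  then obtain B where "\<forall>y\<in>c ` {0..T}. norm y \<le> B" unfolding bounded_iff by blast
  then have B: "\<And>t. t \<in> {0..T} \<Longrightarrow> \<bar>c t\<bar> \<le> B" by auto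
  have "continuous_on UNIV (\<lambda>t. c (cl t))"
    by (rule continuous_on_compose2[OF c ccl]) (use cl in auto)
  then have "continuous_on UNIV q" unfolding q_def by (intro continuous_intros)
  moreover have "\<bar>q t\<bar> \<le> B * \<bar>lam\<bar>" for t
    using B[OF cl] by (auto simp: q_def abs_mult intro!: mult_right_mono)
  ultimately obtain w v where "wave_mode T q 1 w v"
    using continuous_linear_wave_exists[OF T] by blast
  moreover have "q t = c t * lam" if "t \<in> {0..T}" for t using that by (simp add: q_def cl_def)
  ultimately have "wave_mode T c lam w v" by (simp add: wave_mode_def)
  then show ?thesis by blast
qed

lemma nondecreasing_if_DERIV_nonneg_inside:
  fixes f :: "real \<Rightarrow> real"
  assumes "a \<le> b" "continuous_on {a..b} f"
    and d: "\<And>x. a < x \<Longrightarrow> x < b \<Longrightarrow> \<exists>D\<ge>0. (f has_real_derivative D) (at x)"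
  shows "f a \<le> f b"
  using DERIV_nonneg_imp_increasing_open[OF assms(1) _ assms(2)] d by blast

lemma wave_mode_deriv:
  assumes "wave_mode T c lam w v" "0 < t" "t < T"
  shows "(w has_real_derivative v t) (at t)" "(v has_real_derivative - (c t * lam * w t)) (at t)"
  using assms at_within_Icc_at[of 0 t T] by (auto simp: wave_mode_def dest!: bspec[of _ _ t])

lemma wave_mode_continuous:
  assumes "wave_mode T c lam w v"
  shows "continuous_on {0..T} w" "continuous_on {0..T} v"
  using assms unfolding wave_mode_def
  by (meson DERIV_continuous continuous_on_eq_continuous_within)+

text \<open>
  A Gronwall estimate: the squared distance of the two phase points grows at a rate at most
  \<open>2 + lam \<mu>\<close>, apart from a forcing of size \<open>lam \<delta> W\<close>. With \<open>\<delta> = 0\<close> it gives uniqueness.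
\<close>

lemma wave_mode_stability:
  assumes m1: "wave_mode T c1 lam w1 v1" and m2: "wave_mode T c2 lam w2 v2"
    and T: "0 < T" and lam: "0 < lam" and t: "t \<in> {0..T}"
    and c1: "\<And>t. 0 < t \<Longrightarrow> t < T \<Longrightarrow> \<bar>c1 t\<bar> \<le> \<mu>"
    and close: "\<And>t. 0 < t \<Longrightarrow> t < T \<Longrightarrow> \<bar>c1 t - c2 t\<bar> \<le> \<delta>"
    and W: "\<And>t. 0 < t \<Longrightarrow> t < T \<Longrightarrow> \<bar>w2 t\<bar> \<le> W"
  shows "(w1 t - w2 t)\<^sup>2 + (v1 t - v2 t)\<^sup>2 \<le> (lam * \<delta> * W)\<^sup>2 * T * exp ((2 + lam * \<mu>) * T)"
proof -
  define z where "z t = w1 t - w2 t" for t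
  define y where "y t = v1 t - v2 t" for t
  define C where "C = 2 + lam * \<mu>"
  define N where "N = (lam * \<delta> * W)\<^sup>2"
  have "0 \<le> \<mu>" using c1[of "T/2"] T by fastforce
  then have C: "C > 0" using lam by (simp add: C_def add_pos_nonneg)
  define f where "f t = N * t - ((z t)\<^sup>2 + (y t)\<^sup>2) * exp (- C * t)" for t
  have "f 0 \<le> f t"
  proof (rule nondecreasing_if_DERIV_nonneg_inside[where f = f])
    show "0 \<le> t" using t by simp
    show "continuous_on {0..t} f"
      unfolding f_def z_def y_def using t
      by (intro continuous_intros wave_mode_continuous[OF m1, THEN continuous_on_subset]
          wave_mode_continuous[OF m2, THEN continuous_on_subset]) auto
    fix s assume s: "0 < s" "s < t"
    then have sT: "s < T" using t by simp
    let ?y' = "- (c1 s * lam * z s) - lam * (c1 s - c2 s) * w2 s"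
    have dz: "(z has_real_derivative y s) (at s)"
      unfolding z_def y_def using s sT wave_mode_deriv[OF m1] wave_mode_deriv[OF m2]
      by (auto intro!: derivative_eq_intros)
    have dy: "(y has_real_derivative ?y') (at s)"
      unfolding z_def y_def
      by (rule derivative_eq_intros wave_mode_deriv[OF m1] wave_mode_deriv[OF m2] s sT)+
         (simp add: algebra_simps)
    let ?e = "(z s)\<^sup>2 + (y s)\<^sup>2"
    let ?e' = "2 * z s * y s + 2 * y s * ?y'"
    have df: "(f has_real_derivative N - (?e' - C * ?e) * exp (- C * s)) (at s)"
      unfolding f_def
      by (rule derivative_eq_intros dz dy refl)+ (simp add: algebra_simps)
    have "?e' \<le> C * ?e + N"
    proof -
      have 1: "2 * z s * y s \<le> ?e" using sum_squares_bound[of "z s" "y s"] by simp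
      have "- 2 * y s * (c1 s * lam * z s) \<le> \<bar>c1 s\<bar> * (lam * (2 * \<bar>z s\<bar> * \<bar>y s\<bar>))"
        using lam abs_ge_self[of "- 2 * y s * (c1 s * lam * z s)"] by (simp add: abs_mult mult_ac)
      also have "\<dots> \<le> \<mu> * (lam * ?e)"
        using sum_squares_bound[of "\<bar>z s\<bar>" "\<bar>y s\<bar>"] lam c1[OF s(1) sT]
        by (intro mult_mono) auto
      finally have 2: "- 2 * y s * (c1 s * lam * z s) \<le> lam * \<mu> * ?e" by (simp add: mult_ac)
      have "- 2 * y s * (lam * (c1 s - c2 s) * w2 s) \<le> (y s)\<^sup>2 + (lam * (c1 s - c2 s) * w2 s)\<^sup>2"
        using sum_squares_bound[of "- y s" "lam * (c1 s - c2 s) * w2 s"] by simp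
      moreover have "(lam * (c1 s - c2 s) * w2 s)\<^sup>2 \<le> N"
        unfolding N_def
      proof (rule abs_le_square_iff[THEN iffD1])
        have "\<bar>lam * (c1 s - c2 s) * w2 s\<bar> \<le> lam * \<delta> * W"
          using lam close[OF s(1) sT] W[OF s(1) sT]
          by (auto simp: abs_mult intro!: mult_mono order_trans[OF _ close[OF s(1) sT]])
        then show "\<bar>lam * (c1 s - c2 s) * w2 s\<bar> \<le> \<bar>lam * \<delta> * W\<bar>" by linarith
      qed
      moreover have "?e' = 2 * z s * y s + (- 2 * y s * (c1 s * lam * z s))
           + (- 2 * y s * (lam * (c1 s - c2 s) * w2 s))"
        by (simp add: algebra_simps)
      moreover have "C * ?e = ?e + ?e + lam * \<mu> * ?e" by (simp add: C_def algebra_simps)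
      ultimately show ?thesis using 1 2 by (smt (verit) zero_le_power2)
    qed
    then have "(?e' - C * ?e) * exp (- C * s) \<le> N * exp (- C * s)"
      by (intro mult_right_mono) auto
    also have "\<dots> \<le> N * 1"
      using C s by (intro mult_left_mono) (auto simp: N_def)
    finally show "\<exists>D\<ge>0. (f has_real_derivative D) (at s)" using df by (intro exI[of _ "N - (?e' - C * ?e) * exp (- C * s)"]) auto
  qed
  moreover have "f 0 = 0" using m1 m2 by (simp add: f_def z_def y_def wave_mode_def)
  ultimately have "((z t)\<^sup>2 + (y t)\<^sup>2) * exp (- C * t) \<le> N * t" by (simp add: f_def)
  then have "(z t)\<^sup>2 + (y t)\<^sup>2 \<le> N * t * exp (C * t)"
    by (simp add: exp_minus field_simps)
  also have "\<dots> \<le> N * T * exp (C * T)"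
    using t C by (intro mult_mono) (auto simp: N_def)
  finally show ?thesis by (simp add: z_def y_def N_def C_def)
qed

text \<open>
  The derivative of the energy \<open>v\<^sup>2 + lam c w\<^sup>2\<close> along a solution is \<open>lam c' w\<^sup>2\<close>, which is at least
  \<open>- L/\<mu>\<close> times the energy. The rate does not involve \<open>lam\<close>: where the speed is Lipschitz,
  energy is lost at most by a factor that is the same for all frequencies.
\<close>

lemma energy_lower_bound:
  assumes m: "wave_mode T c lam w v" and lam: "0 < lam" and r: "0 < r" "r \<le> t" "t \<le> T"
    and c: "continuous_on {r..T} c" and \<mu>: "0 < \<mu>" "\<And>s. r < s \<Longrightarrow> s < T \<Longrightarrow> \<mu> \<le> c s"
    and d: "\<And>s. r < s \<Longrightarrow> s < T \<Longrightarrow> (c has_real_derivative c' s) (at s)"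
    and L: "\<And>s. r < s \<Longrightarrow> s < T \<Longrightarrow> \<bar>c' s\<bar> \<le> L"
  shows "((v r)\<^sup>2 + lam * c r * (w r)\<^sup>2) * exp (- (L / \<mu>) * (t - r)) \<le> (v t)\<^sup>2 + lam * c t * (w t)\<^sup>2"
proof -
  define f where "f t = ((v t)\<^sup>2 + lam * c t * (w t)\<^sup>2) * exp (L / \<mu> * t)" for t
  have "f r \<le> f t"
  proof (rule nondecreasing_if_DERIV_nonneg_inside[OF r(2)])
    show "continuous_on {r..t} f"
      unfolding f_def using r
      by (intro continuous_intros wave_mode_continuous[OF m, THEN continuous_on_subset]
          c[THEN continuous_on_subset]) auto
    fix s assume s: "r < s" "s < t"
    then have s': "0 < s" "s < T" using r by auto
    let ?D = "(lam * c' s * (w s)\<^sup>2 + (L / \<mu>) * ((v s)\<^sup>2 + lam * c s * (w s)\<^sup>2)) * exp (L / \<mu> * s)"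
    have "(f has_real_derivative ?D) (at s)"
      unfolding f_def
      by (rule derivative_eq_intros wave_mode_deriv[OF m s'] d[OF s(1) s'(2)] refl)+
        (simp add: algebra_simps power2_eq_square)
    moreover have "?D \<ge> 0"
    proof -
      have L0: "L \<ge> 0" using L[OF s(1) s'(2)] by linarith
      have "L \<le> L / \<mu> * c s" using L0 \<mu>(1) \<mu>(2)[OF s(1) s'(2)]
        by (simp add: field_simps mult_left_mono)
      then have "0 \<le> c' s + L / \<mu> * c s" using L[OF s(1) s'(2)] by linarith
      then have "0 \<le> lam * (w s)\<^sup>2 * (c' s + L / \<mu> * c s)" using lam by simp
      moreover have "0 \<le> L / \<mu> * (v s)\<^sup>2" using L0 \<mu> by simp
      ultimately have "0 \<le> lam * c' s * (w s)\<^sup>2 + (L / \<mu>) * ((v s)\<^sup>2 + lam * c s * (w s)\<^sup>2)"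
        by (simp add: algebra_simps)
      then show ?thesis by simp
    qed
    ultimately show "\<exists>D\<ge>0. (f has_real_derivative D) (at s)" by blast
  qed
  then have "((v r)\<^sup>2 + lam * c r * (w r)\<^sup>2) * exp (L / \<mu> * r) / exp (L / \<mu> * t) \<le> (v t)\<^sup>2 + lam * c t * (w t)\<^sup>2"
    unfolding f_def by (simp add: divide_le_eq)
  also have "((v r)\<^sup>2 + lam * c r * (w r)\<^sup>2) * exp (L / \<mu> * r) / exp (L / \<mu> * t) =
    ((v r)\<^sup>2 + lam * c r * (w r)\<^sup>2) * exp (- (L / \<mu>) * (t - r))"
  proof -
    have "exp (L / \<mu> * r) / exp (L / \<mu> * t) = exp (- (L / \<mu>) * (t - r))"
      by (subst exp_diff[symmetric], rule arg_cong[where f = exp]) (simp add: right_diff_distrib)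
    then show ?thesis by (simp only: times_divide_eq_right[symmetric])
  qed
  finally show ?thesis .
qed

section \<open>A resonant coefficient\<close>

text \<open>
  Vanishing to first order at both ends is what makes the extension by zero of class \<open>C\<^sup>1\<close>.
\<close>

lemma cutoff_C1:
  fixes g g' :: "real \<Rightarrow> real"
  assumes PQ: "P \<le> Q"
    and d: "\<And>x. x \<in> {P..Q} \<Longrightarrow> (g has_real_derivative g' x) (at x)"
    and cont: "continuous_on {P..Q} g'"
    and ends: "g P = 0" "g Q = 0" "g' P = 0" "g' Q = 0"
  shows "((\<lambda>x. if x \<in> {P..Q} then g x else 0) has_real_derivative
           (if x \<in> {P..Q} then g' x else 0)) (at x)"
    and "continuous_on UNIV (\<lambda>x. if x \<in> {P..Q} then g' x else 0)"
proof -
  let ?T = "{..P} \<union> {Q..}"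
  have cl: "closure {P..Q} \<inter> closure ?T = {P, Q}" using PQ by auto
  have un: "UNIV = {P..Q} \<union> ?T" using PQ by auto
  have "((\<lambda>x. if x \<in> {P..Q} then g x else 0) has_vector_derivative
           (if x \<in> {P..Q} then g' x else 0)) (at x within UNIV)"
  proof (rule has_vector_derivative_If_within_closures[where T = ?T])
    show "x \<in> {P..Q} \<union> ?T" using un by blast
    show "UNIV = {P..Q} \<union> ?T" by (rule un)
    assume "x \<in> {P..Q} \<union> (closure {P..Q} \<inter> closure ?T)"
    then have "x \<in> {P..Q}" unfolding cl using PQ by auto
    from d[OF this] show "(g has_vector_derivative g' x) (at x within {P..Q} \<union> (closure {P..Q} \<inter> closure ?T))"
      by (simp add: has_real_derivative_iff_has_vector_derivative has_vector_derivative_at_within)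
  next
    assume "x \<in> closure {P..Q}" "x \<in> closure ?T"
    then have "x \<in> {P, Q}" using cl by blast
    then show "g x = 0" "g' x = 0" using ends by auto
  qed auto
  then show "((\<lambda>x. if x \<in> {P..Q} then g x else 0) has_real_derivative
           (if x \<in> {P..Q} then g' x else 0)) (at x)"
    by (simp add: has_real_derivative_iff_has_vector_derivative)
  have "continuous_on ({P..Q} \<union> ?T) (\<lambda>x. if x \<in> {P..Q} then g' x else 0)"
    using ends PQ by (intro continuous_on_If cont) (auto intro!: closed_Un)
  then show "continuous_on UNIV (\<lambda>x. if x \<in> {P..Q} then g' x else 0)" by (simp only: un)
qed

text \<open>
  The coefficient is found by prescribing the solution. For \<open>y(x) = sin x exp (h x)\<close> with
  \<open>h' = k sin\<^sup>2\<close>, a computation gives \<open>y'' = - F y\<close> with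
  \<open>F = 1 - 4 k sin cos - k\<^sup>2 sin\<^sup>4 - k' sin\<^sup>2\<close>. Here \<open>k(x) = K/x (1 - P/x) (1 - x/Q)\<close>, a version of
  \<open>K/x\<close> that vanishes at \<open>P\<close> and \<open>Q\<close>. Because \<open>P\<close> and \<open>Q\<close> are multiples of \<open>\<pi>\<close>, also
  \<open>sin\<close> vanishes there, so that \<open>F - 1\<close> and \<open>h'\<close> vanish to first order at the ends and can be cut
  off outside \<open>[P, Q]\<close>. On average \<open>sin\<^sup>2\<close> is \<open>1/2\<close>, hence \<open>h\<close> grows by about
  \<open>\<integral> K/(2x) dx = K/2 ln (Q/P)\<close> while \<open>F - 1\<close> stays of size \<open>K/P\<close> and \<open>F'\<close> of size \<open>K/x\<close>.

  The solution in this form lives on a universal scale: for frequency \<open>\<gamma>\<close> one uses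
  \<open>F(\<gamma> t)\<close>, and a bound of the form \<open>C/x\<close> on \<open>F'\<close> becomes the bound \<open>C/t\<close> for every \<open>\<gamma>\<close>.
\<close>

lemma resonant_profile:
  fixes K :: real and p q :: nat
  defines "P \<equiv> pi * real p" and "Q \<equiv> pi * real q"
  assumes K: "1 \<le> K" "K \<le> P" and pq: "p < q"
  obtains F F' y y' :: "real \<Rightarrow> real"
  where "\<And>x. (F has_real_derivative F' x) (at x)" and "continuous_on UNIV F'"
    and "\<And>x. x \<notin> {P<..<Q} \<Longrightarrow> F x = 1 \<and> F' x = 0"
    and "\<And>x. \<bar>F x - 1\<bar> \<le> 7 * K / P" and "\<And>x. 0 < x \<Longrightarrow> \<bar>F' x\<bar> \<le> 30 * K / x"
    and "y 0 = 0" and "y' 0 = 1"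
    and "\<And>x. 0 \<le> x \<Longrightarrow> (y has_real_derivative y' x) (at x)"
    and "\<And>x. 0 \<le> x \<Longrightarrow> (y' has_real_derivative - (F x * y x)) (at x)"
    and "\<And>x. Q \<le> x \<Longrightarrow> exp (K * (ln (Q / P) - 3)) \<le> (y x)\<^sup>2 + (y' x)\<^sup>2"
proof -
  have P: "P \<ge> 1" "P > 0" using K by auto
  have PQ: "P < Q" using pq by (simp add: P_def Q_def)
  then have Q: "Q > 0" using P by linarith
  have sP: "sin P = 0" and sQ: "sin Q = 0" by (simp_all add: P_def Q_def)
  define k where "k x = K * ((1 + P/Q) / x - P / x^2 - 1/Q)" for x
  define k1 where "k1 x = K * (2 * P / x^3 - (1 + P/Q) / x^2)" for x
  define k2 where "k2 x = K * (2 * (1 + P/Q) / x^3 - 6 * P / x^4)" for x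
  have dk: "(k has_real_derivative k1 x) (at x)" and dk1: "(k1 has_real_derivative k2 x) (at x)"
    if "0 < x" for x
    unfolding k_def k1_def k2_def using that Q
    by (auto intro!: derivative_eq_intros simp: field_simps eval_nat_numeral)
  have kP: "k P = 0" and kQ: "k Q = 0"
    using P Q by (auto simp: k_def field_simps power2_eq_square)
  have k_fact: "k x = K / x * ((1 - P / x) * (1 - x / Q))" if "0 < x" for x
    using that Q by (simp add: k_def field_simps power2_eq_square)
  have kb: "0 \<le> k x \<and> k x \<le> K / x" if "x \<in> {P..Q}" for x
  proof -
    have x: "0 < x" using that P by auto
    have "0 \<le> 1 - P / x" "1 - P / x \<le> 1" "0 \<le> 1 - x / Q" "1 - x / Q \<le> 1"
      using that x P Q by (auto simp: field_simps)
    then have "0 \<le> (1 - P / x) * (1 - x / Q)" "(1 - P / x) * (1 - x / Q) \<le> 1"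
      by (auto intro: mult_le_one mult_nonneg_nonneg)
    moreover have "0 \<le> K / x" using K x by simp
    ultimately have "0 \<le> K / x * ((1 - P / x) * (1 - x / Q))" "K / x * ((1 - P / x) * (1 - x / Q)) \<le> K / x * 1"
      by (blast intro: mult_nonneg_nonneg mult_left_mono)+
    then show ?thesis using k_fact[OF x] by simp
  qed
  have k1b: "\<bar>k1 x\<bar> \<le> 2 * K / x^2" if "x \<in> {P..Q}" for x
  proof -
    have x: "0 < x" using that P by auto
    have "k1 x = K / x^2 * (2 * (P / x) - (1 + P/Q))"
      using x by (simp add: k1_def field_simps eval_nat_numeral)
    moreover have "\<bar>2 * (P / x) - (1 + P/Q)\<bar> \<le> 2"
    proof -
      have "0 \<le> P / x" "P / x \<le> 1" "0 \<le> P / Q" "P / Q \<le> 1"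
        using that x P Q PQ by (auto simp: field_simps)
      then show ?thesis by linarith
    qed
    ultimately have "\<bar>k1 x\<bar> \<le> K / x^2 * 2"
      using K x by (simp only: abs_mult) (intro mult_mono; simp)
    then show ?thesis by (simp add: mult.commute)
  qed
  have k2b: "\<bar>k2 x\<bar> \<le> 6 * K / x^3" if "x \<in> {P..Q}" for x
  proof -
    have x: "0 < x" using that P by auto
    have "k2 x = K / x^3 * (2 * (1 + P/Q) - 6 * (P / x))"
      using x by (simp add: k2_def field_simps eval_nat_numeral)
    moreover have "\<bar>2 * (1 + P/Q) - 6 * (P / x)\<bar> \<le> 6"
    proof -
      have "\<bar>2 * (1 + a) - 6 * b\<bar> \<le> 6" if "0 \<le> a" "a \<le> 1" "0 \<le> b" "b \<le> 1" for a b :: real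
        unfolding abs_le_iff using that by simp
      moreover have "0 \<le> P / x" "P / x \<le> 1" "0 \<le> P / Q" "P / Q \<le> 1"
        using that x P Q PQ by (auto simp: field_simps)
      ultimately show ?thesis by blast
    qed
    ultimately have "\<bar>k2 x\<bar> \<le> K / x^3 * 6"
      using K x by (simp only: abs_mult) (intro mult_mono; simp)
    then show ?thesis by (simp add: mult.commute)
  qed
  define g where "g x = k x * (sin x)^2" for x
  define g1 where "g1 x = k1 x * (sin x)^2 + 2 * k x * sin x * cos x" for x
  define G where "G x = 4 * k x * sin x * cos x + (k x)^2 * (sin x)^4 + k1 x * (sin x)^2" for x
  define G1 where "G1 x = 4 * k1 x * sin x * cos x + 4 * k x * ((cos x)^2 - (sin x)^2)
     + 2 * k x * k1 x * (sin x)^4 + 4 * (k x)^2 * (sin x)^3 * cos x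
     + k2 x * (sin x)^2 + 2 * k1 x * sin x * cos x" for x
  have dg: "(g has_real_derivative g1 x) (at x)" and dG: "(G has_real_derivative G1 x) (at x)"
    if "x \<in> {P..Q}" for x
  proof -
    have x: "0 < x" using that P by auto
    show "(g has_real_derivative g1 x) (at x)"
      unfolding g_def g1_def
      by (rule derivative_eq_intros dk[OF x] refl)+ (simp add: algebra_simps power2_eq_square)
    show "(G has_real_derivative G1 x) (at x)"
      unfolding G_def G1_def
      by (rule derivative_eq_intros dk[OF x] dk1[OF x] refl)+ (simp add: algebra_simps eval_nat_numeral)
  qed
  have cont: "continuous_on {P..Q} k" "continuous_on {P..Q} k1" "continuous_on {P..Q} k2"
    using P Q unfolding k_def k1_def k2_def by (auto intro!: continuous_intros)
  have cg1: "continuous_on {P..Q} g1" and cG1: "continuous_on {P..Q} G1"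
    unfolding g1_def G1_def by (intro continuous_intros cont)+
  define gc where "gc x = (if x \<in> {P..Q} then g x else 0)" for x
  define gc1 where "gc1 x = (if x \<in> {P..Q} then g1 x else 0)" for x
  define F where "F x = 1 - (if x \<in> {P..Q} then G x else 0)" for x
  define F1 where "F1 x = - (if x \<in> {P..Q} then G1 x else 0)" for x
  have gends: "g P = 0" "g Q = 0" "g1 P = 0" "g1 Q = 0" using sP sQ by (auto simp: g_def g1_def)
  have dgc: "(gc has_real_derivative gc1 x) (at x)" for x
    unfolding gc_def gc1_def by (rule cutoff_C1(1)[OF less_imp_le[OF PQ] dg cg1 gends])
  have Gends: "G P = 0" "G Q = 0" "G1 P = 0" "G1 Q = 0" using sP sQ kP kQ by (auto simp: G_def G1_def)
  have dF: "(F has_real_derivative F1 x) (at x)" for x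
    using DERIV_diff[OF DERIV_const[of 1] cutoff_C1(1)[OF less_imp_le[OF PQ] dG cG1 Gends, of x]]
    unfolding F_def F1_def by simp
  have cF1: "continuous_on UNIV F1"
    unfolding F1_def
    by (intro continuous_on_minus cutoff_C1(2)[OF less_imp_le[OF PQ] dG cG1 Gends])
  have F_out: "F x = 1 \<and> F1 x = 0" if "x \<notin> {P<..<Q}" for x
  proof (cases "x \<in> {P..Q}")
    case True
    then have "x = P \<or> x = Q" using that by auto
    then show ?thesis using Gends by (auto simp: F_def F1_def)
  qed (auto simp: F_def F1_def)
  have sc: "\<bar>sin x\<bar> \<le> 1" "\<bar>cos x\<bar> \<le> 1" for x :: real by auto
  have b: "\<bar>G x\<bar> \<le> 7 * K / P \<and> \<bar>G1 x\<bar> \<le> 30 * K / x" if x: "x \<in> {P..Q}" for x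
  proof -
    have x0: "x \<ge> 1" "x > 0" "x \<ge> K" using x P K by auto
    define r where "r = K / x"
    have r: "0 \<le> r" "r \<le> 1" using x0 K by (auto simp: r_def)
    have ak: "\<bar>k x\<bar> \<le> r" using kb[OF x] by (simp add: r_def)
    have kk: "\<bar>(k x)\<^sup>2\<bar> \<le> r" 
      using power_mono[OF ak, of 2] r mult_left_mono[of r 1 r] by (simp add: power2_eq_square)
    have "K / x^2 \<le> r" "K / x^3 \<le> r"
      using x0 K self_le_power[of x 2] self_le_power[of x 3]
      by (auto simp: r_def intro!: divide_left_mono)
    then have ak1: "\<bar>k1 x\<bar> \<le> 2 * r" and ak2: "\<bar>k2 x\<bar> \<le> 6 * r"
      using k1b[OF x] k2b[OF x] by auto
    have akk1: "\<bar>k x * k1 x\<bar> \<le> 2 * r"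
      using mult_mono[of "\<bar>k x\<bar>" 1 "\<bar>k1 x\<bar>" "2*r"] ak ak1 r by (simp add: abs_mult)
    have s1: "\<bar>sin x ^ n\<bar> \<le> 1" for n by (simp add: power_abs power_le_one)
    have s2: "\<bar>sin x ^ n * cos x\<bar> \<le> 1" for n
      unfolding abs_mult by (rule mult_le_one) (use s1 in auto)
    have s3: "\<bar>sin x * cos x\<bar> \<le> 1" using s2[of 1] by simp
    have c2: "\<bar>(cos x)^2 - (sin x)^2\<bar> \<le> 1"
      using abs_cos_le_one[of "2*x"] by (simp add: cos_double)
    have e: "\<bar>A * B\<bar> \<le> a" if "\<bar>A\<bar> \<le> a" "\<bar>B\<bar> \<le> 1" for A B a :: real
      using mult_mono[OF that] by (simp add: abs_mult) (meson abs_ge_zero order_trans that(1))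
    have t: "\<bar>k x * (sin x * cos x)\<bar> \<le> r" "\<bar>(k x)^2 * (sin x)^4\<bar> \<le> r" "\<bar>k1 x * (sin x)^2\<bar> \<le> 2 * r"
      "\<bar>k1 x * (sin x * cos x)\<bar> \<le> 2 * r" "\<bar>k x * ((cos x)^2 - (sin x)^2)\<bar> \<le> r"
      "\<bar>(k x * k1 x) * (sin x)^4\<bar> \<le> 2 * r" "\<bar>(k x)^2 * ((sin x)^3 * cos x)\<bar> \<le> r" "\<bar>k2 x * (sin x)^2\<bar> \<le> 6 * r"
      by (rule e[OF ak s3] e[OF kk s1] e[OF ak1 s1] e[OF ak1 s3] e[OF ak c2] e[OF akk1 s1] e[OF kk s2] e[OF ak2 s1])+
    have "G x = 4 * (k x * (sin x * cos x)) + (k x)^2 * (sin x)^4 + k1 x * (sin x)^2"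
      by (simp add: G_def)
    then have "\<bar>G x\<bar> \<le> 7 * r" using t by linarith
    also have "r \<le> K / P" using x P K by (auto simp: r_def intro!: divide_left_mono)
    finally have 1: "\<bar>G x\<bar> \<le> 7 * K / P" by simp
    have "G1 x = 4 * (k1 x * (sin x * cos x)) + 4 * (k x * ((cos x)^2 - (sin x)^2))
     + 2 * ((k x * k1 x) * (sin x)^4) + 4 * ((k x)^2 * ((sin x)^3 * cos x))
     + k2 x * (sin x)^2 + 2 * (k1 x * (sin x * cos x))"
      by (simp add: G1_def)
    then have "\<bar>G1 x\<bar> \<le> 30 * r" using t by linarith
    then show ?thesis using 1 by (simp add: r_def)
  qed
  \<comment> \<open>The lower limit \<open>-1\<close> makes \<open>h\<close> differentiable at \<open>0\<close> from both sides; \<open>gc\<close> vanishes up to \<open>P\<close>.\<close>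
  define h where "h x = integral {-1..x} gc" for x
  have cgc: "continuous_on S gc" for S
    by (rule DERIV_continuous_on[OF has_field_derivative_at_within[OF dgc]])
  have dh: "(h has_real_derivative gc x) (at x)" if "x > -1" for x
  proof -
    have "(h has_real_derivative gc x) (at x within {-1..x+1})"
      unfolding h_def by (rule integral_has_real_derivative) (use that cgc in auto)
    then show ?thesis using that at_within_Icc_at[of "-1" x "x+1"] by simp
  qed
  have h0: "h 0 = 0"
  proof -
    have "integral {-1..0} gc = integral {-1..0} (\<lambda>_::real. 0::real)"
      by (rule Henstock_Kurzweil_Integration.integral_cong) (use P in \<open>auto simp: gc_def\<close>)
    then show ?thesis by (simp add: h_def)
  qed
  have gc_nonneg: "0 \<le> gc x" for x using kb by (auto simp: gc_def g_def)
  have ch: "continuous_on {a..b} h" if "a > -1" for a b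
    by (rule DERIV_continuous_on[OF has_field_derivative_at_within[OF dh]]) (use that in auto)
  have hmono: "h a \<le> h b" if "0 \<le> a" "a \<le> b" for a b
  proof (rule nondecreasing_if_DERIV_nonneg_inside[where f = h])
    show "continuous_on {a..b} h" by (rule ch) (use that in simp)
    fix x assume "a < x"
    then have "(h has_real_derivative gc x) (at x)" using that by (intro dh) simp
    then show "\<exists>D\<ge>0. (h has_real_derivative D) (at x)" using gc_nonneg by blast
  qed (use that in simp)
  \<comment> \<open>Up to the last term, \<open>h - f\<close> is \<open>\<integral>k/2\<close> minus \<open>k sin (2x)/4\<close>, which integrates the oscillating part of
    \<open>k sin\<^sup>2\<close> by parts; the derivative of \<open>- K/(2x)\<close> absorbs the remainder \<open>k' sin (2x)/4\<close>.\<close>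
  define f where "f x = h x - K * ((1 + P/Q) * ln x + P / x - x / Q) / 2 + k x * sin (2 * x) / 4 - K / (2 * x)" for x
  have "f P \<le> f Q"
  proof (rule nondecreasing_if_DERIV_nonneg_inside[where f = f])
    have df: "(f has_real_derivative gc x - k x / 2 + k1 x * sin (2*x) / 4 + k x * cos (2*x) / 2 + K / (2 * x^2)) (at x)"
      if "x \<in> {P..Q}" for x
    proof -
      have x: "x > 0" using that P by auto
      have "(f has_real_derivative gc x - K * ((1 + P/Q) / x - P / x^2 - 1 / Q) / 2 
           + (k1 x * sin (2*x) + k x * (2 * cos (2*x))) / 4 + K / (2 * x^2)) (at x)"
        unfolding f_def
        by (rule derivative_eq_intros dh dk refl | use x Q in \<open>simp add: field_simps power2_eq_square\<close>)+
      then show ?thesis by (simp add: k_def field_simps)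
    qed
    show "continuous_on {P..Q} f"
      by (rule DERIV_continuous_on[OF has_field_derivative_at_within[OF df]])
    show "P \<le> Q" using PQ by simp
    fix x assume "P < x" "x < Q"
    then have x: "x \<in> {P..Q}" by auto
    have "gc x = k x / 2 - k x * cos (2*x) / 2"
      unfolding cos_double_sin using x by (simp add: gc_def g_def algebra_simps diff_divide_distrib)
    moreover have "\<bar>k1 x * sin (2*x)\<bar> \<le> 2 * K / x^2"
      using k1b[OF x] mult_mono[OF k1b[OF x] sc(1)[of "2*x"]] K by (simp add: abs_mult)
    moreover have Khalf: "K / (2 * x^2) = (2 * K / x^2) / 4" by simp
    moreover have "0 \<le> G - a / 2 + S / 4 + b / 2 + r / 4" if "G = a / 2 - b / 2" "\<bar>S\<bar> \<le> r"
      for G a S b r :: real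
      using abs_le_D2[OF that(2)] unfolding that(1) by simp
    ultimately have "0 \<le> gc x - k x / 2 + k1 x * sin (2*x) / 4 + k x * cos (2*x) / 2 + K / (2 * x^2)"
      unfolding Khalf by blast
    with df[OF x] show "\<exists>D\<ge>0. (f has_real_derivative D) (at x)" by blast
  qed
  moreover have "h P \<ge> 0" using hmono[of 0 P] h0 P by simp
  ultimately have hQ: "K * (ln (Q/P) - 3) \<le> 2 * h Q"
  proof -
    assume a: "f P \<le> f Q" "0 \<le> h P"
    define r where "r = P / Q"
    have r: "0 \<le> r" using P Q by (simp add: r_def)
    have "2 * f Q = 2 * h Q - K * ((1 + r) * ln Q + r - 1) - K / Q"
      "2 * f P = 2 * h P - K * ((1 + r) * ln P + 1 - r) - K / P"
      using P Q kP kQ by (simp_all add: f_def r_def)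
    then have "K * ((1 + r) * (ln Q - ln P) + 2 * r - 2) + K / Q - K / P \<le> 2 * h Q"
      using a by (simp add: algebra_simps)
    moreover have "0 \<le> K / Q" "K / P \<le> K" using K P Q by (auto simp: field_simps)
    moreover have "K * ((ln Q - ln P) - 2) \<le> K * ((1 + r) * (ln Q - ln P) + 2 * r - 2)"
    proof (rule mult_left_mono)
      have "0 \<le> r * (ln Q - ln P)" using r P PQ by simp
      then show "(ln Q - ln P) - 2 \<le> (1 + r) * (ln Q - ln P) + 2 * r - 2" using r by (simp add: distrib_right)
    qed (use K in simp)
    moreover have "K * (ln (Q/P) - 3) = K * ((ln Q - ln P) - 2) - K" using P Q by (simp add: ln_div algebra_simps)
    ultimately show ?thesis by linarith
  qed
  define y where "y x = sin x * exp (h x)" for x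
  define y1 where "y1 x = (cos x + sin x * gc x) * exp (h x)" for x
  show thesis
  proof (rule that[of F F1 y y1])
    fix x :: real
    show "\<bar>F x - 1\<bar> \<le> 7 * K / P" using b[of x] K P by (auto simp: F_def)
    show "\<bar>F1 x\<bar> \<le> 30 * K / x" if "0 < x" using b[of x] K P that by (auto simp: F1_def)
    show "(y has_real_derivative y1 x) (at x)" if "0 \<le> x"
      unfolding y_def y1_def using that
      by (auto intro!: derivative_eq_intros dh simp: algebra_simps)
    show "(y1 has_real_derivative - (F x * y x)) (at x)" if "0 \<le> x"
    proof -
      have "(y1 has_real_derivative (- sin x + cos x * gc x + sin x * gc1 x + (cos x + sin x * gc x) * gc x) * exp (h x)) (at x)"
        unfolding y1_def
        by (rule derivative_eq_intros dh dgc refl | use that in \<open>simp add: algebra_simps\<close>)+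
      moreover have "- sin x + cos x * gc x + sin x * gc1 x + (cos x + sin x * gc x) * gc x = - (F x * sin x)"
        by (auto simp: gc_def gc1_def F_def g_def g1_def G_def algebra_simps eval_nat_numeral)
      ultimately show ?thesis by (simp add: y_def mult.assoc)
    qed
    show "exp (K * (ln (Q / P) - 3)) \<le> (y x)\<^sup>2 + (y1 x)\<^sup>2" if "Q \<le> x"
    proof -
      have "gc x = 0" using that kQ by (auto simp: gc_def g_def)
      then have "(y x)\<^sup>2 + (y1 x)\<^sup>2 = ((sin x)\<^sup>2 + (cos x)\<^sup>2) * (exp (h x))\<^sup>2"
        by (simp only: y_def y1_def power_mult_distrib distrib_right mult_zero_right add_0_right)
      also have "\<dots> = exp (2 * h x)" by (simp add: exp_double)
      finally show ?thesis using hQ hmono[of Q x] that Q by simp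
    qed
  qed (use dF cF1 F_out h0 P in \<open>auto simp: y_def y1_def gc_def\<close>)
qed

section \<open>Propagation speeds and their perturbation near zero\<close>

lemma square_max_0_C1:
  "((\<lambda>x::real. (max 0 x)\<^sup>2) has_real_derivative 2 * max 0 x) (at x)"
proof -
  have "((\<lambda>x::real. if x \<in> {0..} then x\<^sup>2 else 0) has_vector_derivative
           (if x \<in> {0..} then 2 * x else 0)) (at x within UNIV)"
  proof (rule has_vector_derivative_If_within_closures[where T = "{..0}"])
    show "x \<in> {0..} \<union> {..0}" by auto
    show "UNIV = {0..} \<union> {..0::real}" by auto
    show "((\<lambda>x. x\<^sup>2) has_vector_derivative 2 * x) (at x within {0..} \<union> (closure {0..} \<inter> closure {..0}))"
      by (auto intro!: derivative_eq_intros simp flip: has_real_derivative_iff_has_vector_derivative)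
  qed auto
  moreover have "(\<lambda>x::real. if x \<in> {0..} then x\<^sup>2 else 0) = (\<lambda>x. (max 0 x)\<^sup>2)" by auto
  moreover have "(if x \<in> {0..} then 2 * x else 0) = 2 * max 0 x" by auto
  ultimately show ?thesis by (simp add: has_real_derivative_iff_has_vector_derivative)
qed

text \<open>
  With \<open>m(x) = (max 0 x)\<^sup>2\<close>, which is of class \<open>C\<^sup>1\<close>, the function \<open>1 - m (1 - m y)\<close> is \<open>0\<close> for
  \<open>y \<le> 0\<close> and \<open>1\<close> for \<open>y \<ge> 1\<close>. A transition over \<open>[\<rho>, 2\<rho>]\<close> has a slope of order \<open>1/\<rho>\<close>, hence of
  order \<open>1/t\<close>, the size that the class of propagation speeds allows.
\<close>

lemma smooth_transition:
  fixes \<rho> :: real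
  assumes \<rho>: "0 < \<rho>"
  obtains \<psi> \<psi>' :: "real \<Rightarrow> real"
  where "\<And>t. (\<psi> has_real_derivative \<psi>' t) (at t)" and "continuous_on UNIV \<psi>'"
    and "\<And>t. t \<le> \<rho> \<Longrightarrow> \<psi> t = 0 \<and> \<psi>' t = 0" and "\<And>t. 2 * \<rho> \<le> t \<Longrightarrow> \<psi> t = 1 \<and> \<psi>' t = 0"
    and "\<And>t. 0 \<le> \<psi> t \<and> \<psi> t \<le> 1" and "\<And>t. 0 < t \<Longrightarrow> \<bar>\<psi>' t\<bar> \<le> 8 / t"
proof -
  define m :: "real \<Rightarrow> real" where "m x = (max 0 x)\<^sup>2" for x
  define y where "y t = (t - \<rho>) / \<rho>" for t
  define \<psi> where "\<psi> t = 1 - m (1 - m (y t))" for t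
  define \<psi>' where "\<psi>' t = 2 * max 0 (1 - m (y t)) * (2 * max 0 (y t)) / \<rho>" for t
  have dm: "(m has_real_derivative 2 * max 0 x) (at x)" for x
    unfolding m_def by (rule square_max_0_C1)
  have dy: "(y has_real_derivative 1 / \<rho>) (at t)" for t
    unfolding y_def using \<rho> by (auto intro!: derivative_eq_intros)
  have m1: "m x \<ge> 1" if "x \<ge> 1" for x
    using that by (simp add: m_def max_def)
  have m0: "m x = 0" if "x \<le> 0" for x using that by (simp add: m_def max_def)
  have mr: "0 \<le> m x \<and> (x \<le> 1 \<longrightarrow> m x \<le> 1)" for x by (auto simp: m_def max_def power_le_one)
  show thesis
  proof (rule that[of \<psi> \<psi>'])
    fix t
    have "(\<psi> has_real_derivative - (2 * max 0 (1 - m (y t)) * (- (2 * max 0 (y t) * (1 / \<rho>))))) (at t)"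
      unfolding \<psi>_def
      by (auto intro!: derivative_eq_intros DERIV_chain2[of m] dm dy)
    then show "(\<psi> has_real_derivative \<psi>' t) (at t)" by (simp add: \<psi>'_def)
    have yle: "y t \<le> 0" if "t \<le> \<rho>" using that \<rho> by (simp add: y_def field_simps)
    have yge: "y t \<ge> 1" if "2 * \<rho> \<le> t" using that \<rho> by (simp add: y_def field_simps)
    show "\<psi> t = 0 \<and> \<psi>' t = 0" if "t \<le> \<rho>"
      using m0[OF yle[OF that]] yle[OF that] by (simp add: \<psi>_def \<psi>'_def m_def)
    show 1: "\<psi> t = 1 \<and> \<psi>' t = 0" if "2 * \<rho> \<le> t"
      using m1[OF yge[OF that]] by (simp add: \<psi>_def \<psi>'_def m0 max_def)
    show "0 \<le> \<psi> t \<and> \<psi> t \<le> 1" using mr[of "1 - m (y t)"] mr[of "y t"] by (auto simp: \<psi>_def)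
    show "\<bar>\<psi>' t\<bar> \<le> 8 / t" if "0 < t"
    proof (cases "2 * \<rho> \<le> t")
      case False
      then have "y t \<le> 1" using \<rho> by (simp add: y_def field_simps)
      then have "max 0 (1 - m (y t)) * max 0 (y t) \<le> 1" "0 \<le> max 0 (1 - m (y t)) * max 0 (y t)"
        using mr[of "y t"] by (auto intro!: mult_le_one)
      then have "\<bar>\<psi>' t\<bar> \<le> 4 * 1 / \<rho>"
        using \<rho> unfolding \<psi>'_def by (simp add: abs_mult divide_right_mono)
      also have "\<dots> \<le> 8 / t" using False \<rho> that by (simp add: field_simps)
      finally show ?thesis .
    qed (use 1 that in simp)
  next
    have "continuous_on UNIV y" unfolding y_def using \<rho> by (intro continuous_intros) auto
    then show "continuous_on UNIV \<psi>'" unfolding \<psi>'_def m_def using \<rho> by (intro continuous_intros) auto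
  qed
qed

lemma has_real_derivative_speed_deriv:
  assumes "c \<in> PS1 T0 \<mu>1 \<mu>2 \<omega>" "t \<in> {0<..T0}"
  shows "(c has_real_derivative speed_deriv T0 c t) (at t within {0<..T0})"
  using assms vector_derivative_works[of c "at t within {0<..T0}"]
  unfolding speed_deriv_def PS1_def has_real_derivative_iff_has_vector_derivative differentiable_on_def
  by blast

lemma PS1I:
  assumes ext: "c \<in> extensional {0..T0}" and cont: "continuous_on {0..T0} c"
    and d: "\<And>t. t \<in> {0<..T0} \<Longrightarrow> (c has_real_derivative c' t) (at t within {0<..T0})"
    and c': "continuous_on {0<..T0} c'"
    and b: "\<And>t. t \<in> {0<..<T0} \<Longrightarrow> \<mu>1 \<le> c t \<and> c t \<le> \<mu>2"
    and b': "\<And>t. t \<in> {0<..T0} \<Longrightarrow> \<bar>c' t\<bar> \<le> \<omega> t / t"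
  shows "c \<in> PS1 T0 \<mu>1 \<mu>2 \<omega>" and "\<And>t. t \<in> {0<..T0} \<Longrightarrow> speed_deriv T0 c t = c' t"
proof -
  show sd: "speed_deriv T0 c t = c' t" if t: "t \<in> {0<..T0}" for t
  proof -
    have "at t within {0<..T0} \<noteq> bot"
    proof -
      have "t islimpt {0<..<t}" using t by (intro islimpt_greaterThanLessThan2) auto
      then have "t islimpt {0<..T0}" by (rule islimpt_subset) (use t in auto)
      then show ?thesis by (simp add: trivial_limit_within)
    qed
    moreover have "(c has_vector_derivative c' t) (at t within {0<..T0})"
      using d[OF t] by (simp add: has_real_derivative_iff_has_vector_derivative)
    moreover from this have "(c has_vector_derivative speed_deriv T0 c t) (at t within {0<..T0})"
      unfolding speed_deriv_def vector_derivative_works[symmetric] by (rule differentiableI_vector)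
    ultimately show ?thesis by (metis vector_derivative_unique_within)
  qed
  have "c differentiable_on {0<..T0}"
    unfolding differentiable_on_def using d real_differentiable_def by blast
  moreover have "continuous_on {0<..T0} (speed_deriv T0 c)"
    using c' by (rule continuous_on_eq) (simp add: sd)
  ultimately show "c \<in> PS1 T0 \<mu>1 \<mu>2 \<omega>"
    using ext cont b b' by (simp add: PS1_def sd)
qed

lemma PS1_bounds:
  assumes c: "c \<in> PS1 T0 \<mu>1 \<mu>2 \<omega>" and T0: "0 < T0" and t: "t \<in> {0..T0}"
  shows "c t \<in> {\<mu>1..\<mu>2}"
proof -
  have "continuous_on (closure {0<..<T0}) c" using c T0 by (simp add: PS1_def)
  moreover have "c ` {0<..<T0} \<subseteq> {\<mu>1..\<mu>2}" using c by (auto simp: PS1_def)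
  ultimately have "c ` closure {0<..<T0} \<subseteq> {\<mu>1..\<mu>2}"
    by (intro image_closure_subset) auto
  moreover have "t \<in> closure {0<..<T0}" using t T0 by simp
  ultimately show ?thesis by blast
qed

text \<open>
  The second part of the distance does not see what happens near \<open>t = 0\<close>.
\<close>

lemma weighted_speed_deriv_diff_le:
  assumes c: "c1 \<in> PS1 T0 \<mu>1 \<mu>2 \<omega>" "c2 \<in> PS1 T0 \<mu>1 \<mu>2 \<omega>" and t: "t \<in> {0<..T0}" and \<omega>: "0 < \<omega> t"
  shows "t\<^sup>2 / \<omega> t * \<bar>speed_deriv T0 c1 t - speed_deriv T0 c2 t\<bar> \<le> 2 * t"
proof -
  have "\<bar>speed_deriv T0 c1 t\<bar> \<le> \<omega> t / t" "\<bar>speed_deriv T0 c2 t\<bar> \<le> \<omega> t / t"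
    using c t by (auto simp: PS1_def)
  then have "\<bar>speed_deriv T0 c1 t - speed_deriv T0 c2 t\<bar> \<le> 2 * (\<omega> t / t)" by linarith
  then have "t\<^sup>2 / \<omega> t * \<bar>speed_deriv T0 c1 t - speed_deriv T0 c2 t\<bar> \<le> t\<^sup>2 / \<omega> t * (2 * (\<omega> t / t))"
    using \<omega> by (intro mult_left_mono) auto
  also have "\<dots> = 2 * t" using \<omega> t by (simp add: power2_eq_square)
  finally show ?thesis .
qed

lemma abs_diff_le_dist_PS1:
  assumes c: "c1 \<in> PS1 T0 \<mu>1 \<mu>2 \<omega>" "c2 \<in> PS1 T0 \<mu>1 \<mu>2 \<omega>" and t: "t \<in> {0<..<T0}"
    and \<omega>: "\<And>t. t \<in> {0<..T0} \<Longrightarrow> 0 < \<omega> t"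
  shows "\<bar>c1 t - c2 t\<bar> \<le> dist_PS1 T0 \<mu>1 \<mu>2 \<omega> c1 c2"
proof -
  let ?f = "\<lambda>t. \<bar>c1 t - c2 t\<bar>" and ?I = "{0<..<T0}"
  let ?g = "\<lambda>t. t\<^sup>2 / \<omega> t * \<bar>speed_deriv T0 c1 t - speed_deriv T0 c2 t\<bar>"
  have "bdd_above (?f ` ?I)"
  proof (rule bdd_aboveI2)
    fix t assume "t \<in> ?I"
    then have "c1 t \<in> {\<mu>1..\<mu>2}" "c2 t \<in> {\<mu>1..\<mu>2}" using c by (auto simp: PS1_def)
    then show "?f t \<le> \<mu>2 - \<mu>1" by auto
  qed
  then have 1: "?f t \<le> (SUP t\<in>?I. ?f t)" by (rule cSUP_upper[OF t])
  have "bdd_above (?g ` ?I)"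
  proof (rule bdd_aboveI2)
    fix t assume t: "t \<in> ?I"
    then show "?g t \<le> 2 * T0" using weighted_speed_deriv_diff_le[OF c, of t] \<omega>[of t] by auto
  qed
  then have "?g t \<le> (SUP t\<in>?I. ?g t)" by (rule cSUP_upper[OF t])
  moreover have "0 \<le> ?g t" using \<omega>[of t] t by simp
  ultimately show ?thesis using 1 c by (simp add: dist_PS1_def)
qed

lemma dist_PS1_le:
  assumes c: "c1 \<in> PS1 T0 \<mu>1 \<mu>2 \<omega>" "c2 \<in> PS1 T0 \<mu>1 \<mu>2 \<omega>" and T0: "0 < T0"
    and a: "\<And>t. t \<in> {0<..<T0} \<Longrightarrow> \<bar>c1 t - c2 t\<bar> \<le> a"
    and b: "\<And>t. t \<in> {0<..<T0} \<Longrightarrow> t\<^sup>2 / \<omega> t * \<bar>speed_deriv T0 c1 t - speed_deriv T0 c2 t\<bar> \<le> b"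
  shows "dist_PS1 T0 \<mu>1 \<mu>2 \<omega> c1 c2 \<le> a + b"
proof -
  have "{0<..<T0} \<noteq> {}" using T0 by simp
  then have "(SUP t\<in>{0<..<T0}. \<bar>c1 t - c2 t\<bar>) \<le> a"
    "(SUP t\<in>{0<..<T0}. t\<^sup>2 / \<omega> t * \<bar>speed_deriv T0 c1 t - speed_deriv T0 c2 t\<bar>) \<le> b"
    using a b by (auto intro: cSUP_least)
  then show ?thesis using c by (simp add: dist_PS1_def)
qed

text \<open>
  Any speed can be replaced, at small cost, by one that on \<open>[0, \<rho>]\<close> is the constant \<open>c0\<close> times a
  rescaled profile \<open>F\<close>, with \<open>\<rho>\<close> and the start \<open>pi * p\<close> of the profile independent of the
  frequency \<open>\<gamma>\<close>. Room for the perturbation is made first: \<open>c1 = (1 - \<eta>) c + \<eta> (\<mu>1 + \<mu>2)/2\<close> stays away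
  from \<open>\<mu>1\<close> and \<open>\<mu>2\<close> and keeps a fraction \<open>\<eta>\<close> of the bound \<open>\<omega>(t)/t\<close> in reserve. The new speed is
  \<open>c0 F(\<gamma> t) + \<psi>(t) (c1(t) - c0)\<close> with \<open>c0 = c1(0)\<close> and \<open>\<psi>\<close> the transition above. The oscillation
  uses the bound on the derivative before \<open>\<rho>\<close>, where \<open>\<omega> \<ge> 30 K \<mu>2\<close>. After \<open>\<rho>\<close> the transition
  uses the reserve \<open>\<eta>\<close>, which suffices because \<open>c1\<close> is close to \<open>c0\<close> on \<open>[\<rho>, 2\<rho>]\<close>.
\<close>

lemma perturb_speed_near_zero:
  assumes c: "c \<in> PS1 T0 \<mu>1 \<mu>2 \<omega>" and T0: "0 < T0" and \<mu>: "0 < \<mu>1" "\<mu>1 < \<mu>2"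
    and \<omega>: "\<And>t. t \<in> {0<..T0} \<Longrightarrow> 0 < \<omega> t" and anti: "antimono_on {0<..T0} \<omega>"
    and lim: "filterlim \<omega> at_top (at_right 0)"
    and \<epsilon>: "0 < \<epsilon>" and \<tau>: "0 < \<tau>" and K: "1 \<le> K"
  obtains c0 \<rho> :: real and p :: nat
  where "c0 \<in> {\<mu>1..\<mu>2}" "0 < \<rho>" "\<rho> < T0" "\<rho> \<le> \<tau>" "K \<le> pi * real p"
    and "\<And>F F' \<gamma> Q. \<lbrakk>\<And>x. (F has_real_derivative F' x) (at x); continuous_on UNIV F';
        \<And>x. Q \<le> x \<Longrightarrow> F x = 1 \<and> F' x = 0; \<And>x. \<bar>F x - 1\<bar> \<le> 7 * K / (pi * real p);
        \<And>x. 0 < x \<Longrightarrow> \<bar>F' x\<bar> \<le> 30 * K / x; 0 < \<gamma>; Q \<le> \<gamma> * \<rho>\<rbrakk> \<Longrightarrow>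
       \<exists>c2\<in>PS1 T0 \<mu>1 \<mu>2 \<omega>. dist_PS1 T0 \<mu>1 \<mu>2 \<omega> c c2 < \<epsilon> \<and> (\<forall>t\<in>{0..\<rho>}. c2 t = c0 * F (\<gamma> * t))"
proof -
  define e where "e = \<epsilon> / 8"
  define \<sigma> where "\<sigma> = (\<mu>2 - \<mu>1) / 2"
  define \<eta> where "\<eta> = min (1/2) (min (e / \<sigma>) (e / T0))"
  have pos: "0 < e" "0 < \<sigma>" using \<epsilon> \<mu> by (auto simp: e_def \<sigma>_def)
  have "0 < \<eta>" using pos T0 by (simp add: \<eta>_def)
  moreover have "\<eta> \<le> 1/2" unfolding \<eta>_def by linarith
  ultimately have \<eta>: "0 < \<eta>" "\<eta> \<le> 1/2" .
  have "\<eta> \<le> e / \<sigma>" "\<eta> \<le> e / T0" unfolding \<eta>_def by linarith+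
  then have \<eta>e: "\<eta> * \<sigma> \<le> e" "\<eta> * T0 \<le> e" using pos T0 by (auto simp: field_simps)
  define c1 where "c1 t = (1 - \<eta>) * c t + \<eta> * (\<mu>1 + \<sigma>)" for t
  define c0 where "c0 = c1 0"
  have cb: "\<mu>1 \<le> c t \<and> c t \<le> \<mu>2" if "t \<in> {0..T0}" for t using PS1_bounds[OF c T0 that] by simp
  have c1b: "\<mu>1 + \<eta> * \<sigma> \<le> c1 t \<and> c1 t \<le> \<mu>2 - \<eta> * \<sigma>" if "t \<in> {0..T0}" for t
  proof -
    have "0 \<le> (1 - \<eta>) * (c t - \<mu>1)" "0 \<le> (1 - \<eta>) * (\<mu>2 - c t)" using \<eta> cb[OF that] by auto
    moreover have "\<mu>2 = \<mu>1 + 2 * \<sigma>" by (simp add: \<sigma>_def field_simps)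
    ultimately show ?thesis by (simp add: c1_def algebra_simps)
  qed
  have c1c: "\<bar>c t - c1 t\<bar> \<le> \<eta> * \<sigma>" if "t \<in> {0..T0}" for t
  proof -
    have "c t - c1 t = \<eta> * (c t - (\<mu>1 + \<sigma>))" by (simp add: c1_def algebra_simps)
    moreover have "\<bar>c t - (\<mu>1 + \<sigma>)\<bar> \<le> \<sigma>"
      using cb[OF that] unfolding abs_le_iff by (simp add: \<sigma>_def field_simps)
    ultimately show ?thesis using \<eta> by (simp add: abs_mult)
  qed
  have c0b: "\<mu>1 + \<eta> * \<sigma> \<le> c0" "c0 \<le> \<mu>2 - \<eta> * \<sigma>" using c1b[of 0] T0 by (auto simp: c0_def)
  have \<eta>\<sigma>: "0 < \<eta> * \<sigma>" using \<eta> pos by simp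
  then have c0: "c0 \<in> {\<mu>1..\<mu>2}" "0 < c0" using c0b \<mu> by auto
  have ccont: "continuous_on {0..T0} c" using c by (simp add: PS1_def)
  then have c1cont: "continuous_on {0..T0} c1" unfolding c1_def by (intro continuous_intros)
  define \<tau>1 where "\<tau>1 = min e (\<eta> * \<omega> T0 / 8)"
  have \<omega>T0: "0 < \<omega> T0" using \<omega> T0 by simp
  have \<tau>1: "0 < \<tau>1" "\<tau>1 \<le> e" "8 * \<tau>1 \<le> \<eta> * \<omega> T0" using pos \<eta> \<omega>T0 by (auto simp: \<tau>1_def)
  obtain d where d: "d > 0" "\<And>t. t \<in> {0..T0} \<Longrightarrow> \<bar>t\<bar> < d \<Longrightarrow> \<bar>c1 t - c0\<bar> < \<tau>1"
    using c1cont \<tau>1 T0 unfolding continuous_on_iff c0_def dist_real_def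
    by (metis atLeastAtMost_iff diff_zero order_refl less_imp_le)
  have "eventually (\<lambda>t. 30 * K * \<mu>2 \<le> \<omega> t) (at_right 0)"
    using lim by (auto simp: filterlim_at_top)
  then obtain b where b: "b > 0" "\<And>t. 0 < t \<Longrightarrow> t < b \<Longrightarrow> 30 * K * \<mu>2 \<le> \<omega> t"
    by (auto simp: eventually_at_right_field)
  define \<rho> where "\<rho> = min (min (T0 / 4) (d / 4)) (min (b / 2) (min \<tau> (e / 4)))"
  have \<rho>: "0 < \<rho>" "4 * \<rho> \<le> T0" "4 * \<rho> \<le> d" "2 * \<rho> \<le> b" "\<rho> \<le> \<tau>" "4 * \<rho> \<le> e"
    using T0 d b \<tau> pos unfolding \<rho>_def by auto
  have \<rho>T: "\<rho> < T0" "2 * \<rho> < T0" using \<rho> T0 by auto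
  have osc: "\<bar>c1 t - c0\<bar> \<le> \<tau>1" if "t \<in> {0..2*\<rho>}" for t
    using d(2)[of t] that \<rho> by fastforce
  have \<omega>mono: "\<omega> t \<le> \<omega> s" if "0 < s" "s \<le> t" "t \<le> T0" for s t
    using anti that by (auto simp: monotone_on_def)
  have \<omega>\<rho>: "30 * K * \<mu>2 \<le> \<omega> \<rho>" using b(2)[of \<rho>] \<rho> by simp
  obtain p :: nat where p: "max K (7 * K * \<mu>2 / (\<eta> * \<sigma>)) \<le> real p"
    using real_arch_simple by blast
  define P where "P = pi * real p"
  have "real p \<le> P" unfolding P_def using pi_ge_two mult_right_mono[of 1 pi "real p"] by simp
  then have P: "K \<le> P" "7 * K * \<mu>2 / (\<eta> * \<sigma>) \<le> P" using p by auto
  then have P0: "0 < P" using K by simp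
  have KP: "7 * K / P * \<mu>2 \<le> \<eta> * \<sigma>" using P P0 \<eta>\<sigma> by (simp add: field_simps)
  obtain \<psi> \<psi>' where \<psi>: "\<And>t. (\<psi> has_real_derivative \<psi>' t) (at t)" "continuous_on UNIV \<psi>'"
    "\<And>t. t \<le> \<rho> \<Longrightarrow> \<psi> t = 0 \<and> \<psi>' t = 0" "\<And>t. 2 * \<rho> \<le> t \<Longrightarrow> \<psi> t = 1 \<and> \<psi>' t = 0"
    "\<And>t. 0 \<le> \<psi> t \<and> \<psi> t \<le> 1" "\<And>t. 0 < t \<Longrightarrow> \<bar>\<psi>' t\<bar> \<le> 8 / t"
    using smooth_transition[OF \<rho>(1)] by metis
  show thesis
  proof (rule that[of c0 \<rho> p])
    fix F F' :: "real \<Rightarrow> real" and \<gamma> Q :: real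
    assume F: "\<And>x. (F has_real_derivative F' x) (at x)" "continuous_on UNIV F'"
      and F_out: "\<And>x. Q \<le> x \<Longrightarrow> F x = 1 \<and> F' x = 0"
      and Fb: "\<And>x. \<bar>F x - 1\<bar> \<le> 7 * K / (pi * real p)"
      and F'b: "\<And>x. 0 < x \<Longrightarrow> \<bar>F' x\<bar> \<le> 30 * K / x"
      and \<gamma>: "0 < \<gamma>" "Q \<le> \<gamma> * \<rho>"
    define f where "f t = c0 * F (\<gamma> * t) + \<psi> t * (c1 t - c0)" for t
    define D where "D t = c0 * (F' (\<gamma> * t) * \<gamma>) + \<psi>' t * (c1 t - c0) + \<psi> t * ((1 - \<eta>) * speed_deriv T0 c t)" for t
    define c2 where "c2 = restrict f {0..T0}"
    have F1: "F (\<gamma> * t) = 1 \<and> F' (\<gamma> * t) = 0" if "\<rho> \<le> t" for t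
      using F_out[OF order_trans[OF \<gamma>(2) mult_left_mono[OF that]]] \<gamma> by simp
    have amp: "\<bar>c0 * F (\<gamma> * t) - c0\<bar> \<le> \<eta> * \<sigma>" for t
    proof -
      have "c0 * F (\<gamma> * t) - c0 = c0 * (F (\<gamma> * t) - 1)" by (simp add: algebra_simps)
      then have "\<bar>c0 * F (\<gamma> * t) - c0\<bar> = c0 * \<bar>F (\<gamma> * t) - 1\<bar>" using c0 by (simp add: abs_mult)
      also have "\<dots> \<le> \<mu>2 * (7 * K / P)"
        using c0 Fb[of "\<gamma> * t"] by (intro mult_mono) (auto simp: P_def)
      also have "\<dots> \<le> \<eta> * \<sigma>" using KP by (simp add: mult.commute)
      finally show ?thesis .
    qed
    have dF\<gamma>: "((\<lambda>t. F (\<gamma> * t)) has_real_derivative F' (\<gamma> * t) * \<gamma>) (at t within S)" for t S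
      by (rule has_field_derivative_at_within)
         (auto intro!: derivative_eq_intros DERIV_chain2[of F] F)
    have fcont: "continuous_on {0..T0} f"
    proof -
      have "continuous_on {0..T0} (\<lambda>t. F (\<gamma> * t))" using dF\<gamma> by (rule DERIV_continuous_on)
      moreover have "continuous_on {0..T0} \<psi>"
        by (rule DERIV_continuous_on[OF has_field_derivative_at_within[OF \<psi>(1)]])
      ultimately show ?thesis unfolding f_def using c1cont by (intro continuous_intros)
    qed
    have fd: "(f has_real_derivative D t) (at t within {0<..T0})" if t: "t \<in> {0<..T0}" for t
    proof -
      have "(c1 has_real_derivative (1 - \<eta>) * speed_deriv T0 c t) (at t within {0<..T0})"
        unfolding c1_def by (auto intro!: derivative_eq_intros has_real_derivative_speed_deriv[OF c t])
      then show ?thesis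
        unfolding f_def D_def
        by (auto intro!: derivative_eq_intros dF\<gamma> has_field_derivative_at_within[OF \<psi>(1)])
    qed
    have Dcont: "continuous_on {0<..T0} D"
    proof -
      have "continuous_on {0<..T0} (\<lambda>t. F' (\<gamma> * t))"
        by (rule continuous_on_compose2[OF F(2)]) (auto intro!: continuous_intros)
      moreover have "continuous_on {0<..T0} \<psi>'" using \<psi>(2) by (rule continuous_on_subset) auto
      moreover have "continuous_on {0<..T0} \<psi>"
        by (rule DERIV_continuous_on[OF has_field_derivative_at_within[OF \<psi>(1)]])
      moreover have "continuous_on {0<..T0} c1" using c1cont by (rule continuous_on_subset) auto
      moreover have "continuous_on {0<..T0} (speed_deriv T0 c)" using c by (simp add: PS1_def)
      ultimately show ?thesis unfolding D_def by (intro continuous_intros)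
    qed
    have fb: "\<mu>1 \<le> f t \<and> f t \<le> \<mu>2" if t: "t \<in> {0..T0}" for t
    proof (cases "t \<le> \<rho>")
      case True
      then have "f t = c0 * F (\<gamma> * t)" using \<psi>(3) by (simp add: f_def)
      then show ?thesis using amp[of t] c0b by linarith
    next
      case False
      then have "f t = (1 - \<psi> t) * c0 + \<psi> t * c1 t" using F1[of t] by (simp add: f_def algebra_simps)
      moreover have "c0 \<in> {\<mu>1..\<mu>2}" "c1 t \<in> {\<mu>1..\<mu>2}" using c0 c1b[OF t] \<eta>\<sigma> by auto
      ultimately show ?thesis
        using convex_bound_le[of c0 \<mu>2 "c1 t" "1 - \<psi> t" "\<psi> t"] 
          convex_bound_le[of "- c0" "- \<mu>1" "- c1 t" "1 - \<psi> t" "\<psi> t"] \<psi>(5)[of t] by auto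
    qed
    have sdb: "\<bar>speed_deriv T0 c t\<bar> \<le> \<omega> t / t" if "t \<in> {0<..T0}" for t using c that by (simp add: PS1_def)
    have Db: "\<bar>D t\<bar> \<le> \<omega> t / t" if t: "t \<in> {0<..T0}" for t
    proof (cases "t \<le> \<rho>")
      case True
      have t0: "0 < t" using t by simp
      have "\<bar>D t\<bar> = c0 * \<gamma> * \<bar>F' (\<gamma> * t)\<bar>" using \<psi>(3)[OF True] c0 \<gamma> by (simp add: D_def abs_mult)
      also have "\<dots> \<le> c0 * \<gamma> * (30 * K / (\<gamma> * t))"
        using c0 \<gamma> t0 by (intro mult_left_mono F'b) auto
      also have "\<dots> = c0 * (30 * K) / t" using \<gamma> t0 by simp
      also have "\<dots> \<le> \<mu>2 * (30 * K) / t" using c0 K t0 by (intro divide_right_mono mult_right_mono) auto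
      also have "\<dots> \<le> \<omega> t / t"
        using \<omega>\<rho> \<omega>mono[of t \<rho>] True t0 \<rho>T by (intro divide_right_mono) (auto simp: mult_ac)
      finally show ?thesis .
    next
      case False
      have t0: "0 < t" using t by simp
      have "\<bar>\<psi>' t * (c1 t - c0)\<bar> \<le> \<eta> * \<omega> t / t"
      proof (cases "t \<le> 2 * \<rho>")
        case True
        have "\<bar>\<psi>' t * (c1 t - c0)\<bar> \<le> 8 / t * \<tau>1"
          unfolding abs_mult using True t0 by (intro mult_mono \<psi>(6) osc) auto
        also have "\<dots> \<le> \<eta> * \<omega> t / t"
        proof -
          have "\<eta> * \<omega> T0 \<le> \<eta> * \<omega> t" using \<omega>mono[of t T0] t \<eta> by (intro mult_left_mono) auto
          then show ?thesis using \<tau>1(3) t0 by (simp add: divide_right_mono)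
        qed
        finally show ?thesis .
      next
        case False
        then show ?thesis using \<psi>(4)[of t] \<eta> \<omega>[OF t] t0 by simp
      qed
      moreover have "\<bar>\<psi> t * ((1 - \<eta>) * speed_deriv T0 c t)\<bar> \<le> 1 * ((1 - \<eta>) * (\<omega> t / t))"
        unfolding abs_mult using \<psi>(5)[of t] \<eta> sdb[OF t] by (intro mult_mono) auto
      moreover have "D t = \<psi>' t * (c1 t - c0) + \<psi> t * ((1 - \<eta>) * speed_deriv T0 c t)"
        using F1[of t] False by (simp add: D_def)
      moreover have "\<eta> * \<omega> t / t + 1 * ((1 - \<eta>) * (\<omega> t / t)) = \<omega> t / t"
        by (simp add: algebra_simps diff_divide_distrib)
      ultimately show ?thesis by linarith
    qed
    have c2d: "(c2 has_real_derivative D t) (at t within {0<..T0})" if t: "t \<in> {0<..T0}" for t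
      unfolding has_field_derivative_def
      by (rule has_derivative_transform[OF t _ fd[OF t, unfolded has_field_derivative_def]])
         (auto simp: c2_def)
    have c2cont: "continuous_on {0..T0} c2"
      using fcont by (rule continuous_on_eq) (simp add: c2_def)
    have c2: "c2 \<in> PS1 T0 \<mu>1 \<mu>2 \<omega>" and sd2: "\<And>t. t \<in> {0<..T0} \<Longrightarrow> speed_deriv T0 c2 t = D t"
      using PS1I[of c2 T0 D \<mu>1 \<mu>2 \<omega>] c2cont c2d Dcont Db fb by (auto simp: c2_def)
    have "dist_PS1 T0 \<mu>1 \<mu>2 \<omega> c c2 \<le> 3 * e + e"
    proof (rule dist_PS1_le[OF c c2 T0])
      fix t assume t: "t \<in> {0<..<T0}"
      have c2t: "c2 t = f t" using t by (simp add: c2_def)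
      have 1: "\<bar>c t - c1 t\<bar> \<le> e" using c1c[of t] \<eta>e t by auto
      show "\<bar>c t - c2 t\<bar> \<le> 3 * e"
      proof (cases "t < 2 * \<rho>")
        case True
        then have 2: "\<bar>c1 t - c0\<bar> \<le> e" using osc[of t] \<tau>1 t by auto
        have 3: "\<bar>c0 * F (\<gamma> * t) - c0\<bar> \<le> e" using amp[of t] \<eta>e by linarith
        have "f t - c1 t = (c0 * F (\<gamma> * t) - c0) + (\<psi> t - 1) * (c1 t - c0)"
          by (simp add: f_def algebra_simps)
        moreover have "\<bar>(\<psi> t - 1) * (c1 t - c0)\<bar> \<le> 1 * e"
          unfolding abs_mult using 2 \<psi>(5)[of t] by (intro mult_mono) auto
        ultimately show ?thesis using 1 3 unfolding c2t by linarith
      next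
        case False
        then have "f t = c1 t" using \<psi>(4)[of t] F1[of t] \<rho> by (simp add: f_def)
        then show ?thesis using 1 pos c2t by simp
      qed
      have t': "t \<in> {0<..T0}" and t0: "0 < t" using t by auto
      show "t\<^sup>2 / \<omega> t * \<bar>speed_deriv T0 c t - speed_deriv T0 c2 t\<bar> \<le> e"
      proof (cases "t < 2 * \<rho>")
        case True
        then show ?thesis using weighted_speed_deriv_diff_le[OF c c2 t' \<omega>[OF t']] \<rho> by linarith
      next
        case False
        then have "speed_deriv T0 c2 t = (1 - \<eta>) * speed_deriv T0 c t"
          using \<psi>(4)[of t] F1[of t] \<rho> sd2[OF t'] by (simp add: D_def)
        then have "speed_deriv T0 c t - speed_deriv T0 c2 t = \<eta> * speed_deriv T0 c t"
          by (simp add: algebra_simps)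
        then have "\<bar>speed_deriv T0 c t - speed_deriv T0 c2 t\<bar> = \<eta> * \<bar>speed_deriv T0 c t\<bar>"
          using \<eta> by (simp add: abs_mult)
        also have "\<dots> \<le> \<eta> * (\<omega> t / t)" using \<eta> sdb[OF t'] by (intro mult_left_mono) auto
        finally have "t\<^sup>2 / \<omega> t * \<bar>speed_deriv T0 c t - speed_deriv T0 c2 t\<bar> \<le> t\<^sup>2 / \<omega> t * (\<eta> * (\<omega> t / t))"
          using \<omega>[OF t'] by (intro mult_left_mono) auto
        also have "\<dots> = \<eta> * t" using \<omega>[OF t'] t0 by (simp add: power2_eq_square)
        also have "\<dots> \<le> \<eta> * T0" using \<eta> t by (intro mult_left_mono) auto
        finally show ?thesis using \<eta>e by linarith
      qed
    qed
    also have "\<dots> < \<epsilon>" using \<epsilon> by (simp add: e_def)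
    finally have "dist_PS1 T0 \<mu>1 \<mu>2 \<omega> c c2 < \<epsilon>" .
    moreover have "\<forall>t\<in>{0..\<rho>}. c2 t = c0 * F (\<gamma> * t)"
      using \<rho>T \<psi>(3) by (simp add: c2_def f_def)
    ultimately show "\<exists>c2\<in>PS1 T0 \<mu>1 \<mu>2 \<omega>. dist_PS1 T0 \<mu>1 \<mu>2 \<omega> c c2 < \<epsilon> \<and> (\<forall>t\<in>{0..\<rho>}. c2 t = c0 * F (\<gamma> * t))"
      using c2 by blast
  qed (use c0 \<rho> \<rho>T P in \<open>auto simp: P_def\<close>)
qed

section \<open>Amplifying speeds form open dense sets\<close>

definition amplifying :: "real \<Rightarrow> (nat \<Rightarrow> real) \<Rightarrow> nat \<Rightarrow> (real \<Rightarrow> real) \<Rightarrow> bool" where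
  "amplifying T l m c \<longleftrightarrow> (\<exists>n w v. real m + 2 < l n \<and> wave_mode T c (l n) w v \<and>
     (\<forall>t\<in>{1 / (real m + 1)..T}. l n ^ (4 * m) < (v t)\<^sup>2 + l n * (w t)\<^sup>2))"

lemma wave_mode_unique:
  assumes m1: "wave_mode T c lam w1 v1" and m2: "wave_mode T c lam w2 v2"
    and T: "0 < T" and lam: "0 < lam" and t: "t \<in> {0..T}" and c: "continuous_on {0..T} c"
  shows "w1 t = w2 t" "v1 t = v2 t"
proof -
  have "bounded (c ` {0..T})" "bounded (w2 ` {0..T})"
    by (intro compact_imp_bounded compact_continuous_image c wave_mode_continuous(1)[OF m2]; simp)+
  then obtain \<mu> W where "\<forall>y\<in>c ` {0..T}. norm y \<le> \<mu>" "\<forall>y\<in>w2 ` {0..T}. norm y \<le> W"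
    unfolding bounded_iff by blast
  then have "(w1 t - w2 t)\<^sup>2 + (v1 t - v2 t)\<^sup>2 \<le> (lam * 0 * W)\<^sup>2 * T * exp ((2 + lam * \<mu>) * T)"
    by (intro wave_mode_stability[OF m1 m2 T lam t]) auto
  then have "(w1 t - w2 t)\<^sup>2 + (v1 t - v2 t)\<^sup>2 \<le> 0" by simp
  then show "w1 t = w2 t" "v1 t = v2 t"
    by (simp_all add: sum_power2_le_zero_iff)
qed

lemma wave_mode_initial_segment:
  assumes "wave_mode T c lam w v" "r \<le> T"
  shows "wave_mode r c lam w v"
  using assms unfolding wave_mode_def
  by (auto intro: DERIV_subset[where s = "{0..T}"])

text \<open>
  The order of the choices matters: \<open>K = 8m + 2\<close> first, then \<open>\<rho>\<close> and the start \<open>P\<close> of the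
  resonance, and only then an eigenvalue. As \<open>Q \<approx> \<gamma> \<rho>\<close> with \<open>\<gamma> = sqrt (c0 lam)\<close>, the energy
  \<open>(Q/P)\<^sup>K\<close> gained up to time \<open>\<rho>\<close> is a constant times \<open>lam\<^sup>4\<^sup>m\<^sup>+\<^sup>1\<close>, and the constant, as well as the
  factor lost after \<open>\<rho>\<close>, is beaten by the extra power of \<open>lam\<close>.
\<close>

lemma dense_amplifying:
  assumes c: "c \<in> PS1 T0 \<mu>1 \<mu>2 \<omega>" and T0: "0 < T0" and \<mu>: "0 < \<mu>1" "\<mu>1 < \<mu>2"
    and \<omega>: "\<And>t. t \<in> {0<..T0} \<Longrightarrow> 0 < \<omega> t" and anti: "antimono_on {0<..T0} \<omega>"
    and lim: "filterlim \<omega> at_top (at_right 0)"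
    and l: "\<not> bdd_above (range l)" and \<epsilon>: "0 < \<epsilon>"
  shows "\<exists>c2\<in>PS1 T0 \<mu>1 \<mu>2 \<omega>. dist_PS1 T0 \<mu>1 \<mu>2 \<omega> c c2 < \<epsilon> \<and> amplifying T0 l m c2"
proof -
  define N where "N = 8 * m + 2"
  define K where "K = real N"
  have K: "1 \<le> K" by (simp add: K_def N_def)
  have \<tau>: "0 < 1 / (real m + 1)" by simp
  obtain c0 \<rho> p where c0: "c0 \<in> {\<mu>1..\<mu>2}" and \<rho>: "0 < \<rho>" "\<rho> < T0" "\<rho> \<le> 1 / (real m + 1)"
    and p: "K \<le> pi * real p"
    and pert: "\<And>F F' \<gamma> Q. \<lbrakk>\<And>x. (F has_real_derivative F' x) (at x); continuous_on UNIV F';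
        \<And>x. Q \<le> x \<Longrightarrow> F x = 1 \<and> F' x = 0; \<And>x. \<bar>F x - 1\<bar> \<le> 7 * K / (pi * real p);
        \<And>x. 0 < x \<Longrightarrow> \<bar>F' x\<bar> \<le> 30 * K / x; 0 < \<gamma>; Q \<le> \<gamma> * \<rho>\<rbrakk> \<Longrightarrow>
       \<exists>c2\<in>PS1 T0 \<mu>1 \<mu>2 \<omega>. dist_PS1 T0 \<mu>1 \<mu>2 \<omega> c c2 < \<epsilon> \<and> (\<forall>t\<in>{0..\<rho>}. c2 t = c0 * F (\<gamma> * t))"
    by (rule perturb_speed_near_zero[OF c T0 \<mu> \<omega> anti lim \<epsilon> \<tau> K]) blast+
  have c0pos: "0 < c0" using c0 \<mu> by auto
  define P where "P = pi * real p"
  have P: "1 \<le> P" "K \<le> P" using p K by (auto simp: P_def)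
  define L where "L = \<omega> \<rho> / \<rho>"
  have L: "0 \<le> L" using \<omega>[of \<rho>] \<rho> by (simp add: L_def)
  define B where "B = \<rho> * sqrt c0 / (2 * P)"
  have B: "0 < B" using \<rho> c0pos P by (simp add: B_def)
  \<comment> \<open>\<open>B sqrt lam\<close> will be a lower bound for \<open>Q/P\<close>, and \<open>Z lam\<^sup>4\<^sup>m\<^sup>+\<^sup>1\<close> one for the final energy; \<open>lam > Y\<^sup>2\<close> makes
    \<open>\<gamma> \<rho>\<close> so large that a multiple of \<open>\<pi>\<close> fits between \<open>P\<close> and \<open>\<gamma> \<rho>\<close>, at least half way up.\<close>
  define Z where "Z = B ^ N * exp (- 3 * K) * exp (- (L / \<mu>1) * T0)"
  have Z: "0 < Z" using B by (simp add: Z_def)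
  define Y where "Y = ((2 * pi + P + pi) / (\<rho> * sqrt c0))"
  have Y: "0 \<le> Y" using \<rho> c0pos P by (simp add: Y_def)
  obtain n where n: "l n > max (real m + 2) (max (Y\<^sup>2) ((1 + \<mu>2) / Z))"
    using l unfolding bdd_above_def by (metis UNIV_I image_iff not_le)
  define lam where "lam = l n"
  have lam: "real m + 2 < lam" "Y\<^sup>2 < lam" "(1 + \<mu>2) / Z < lam" using n by (auto simp: lam_def)
  have lam0: "0 < lam" "1 \<le> lam" using lam(1) by auto
  define \<gamma> where "\<gamma> = sqrt c0 * sqrt lam"
  have \<gamma>: "0 < \<gamma>" "\<gamma>\<^sup>2 = lam * c0" using c0pos lam0 by (auto simp: \<gamma>_def power_mult_distrib)
  have "Y < sqrt lam" using lam(2) Y by (simp add: real_less_rsqrt)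
  then have big: "2 * pi + P + pi < \<gamma> * \<rho>"
    using \<rho> c0pos by (simp add: Y_def \<gamma>_def field_simps)
  define q where "q = nat \<lfloor>\<gamma> * \<rho> / pi\<rfloor>"
  define Q where "Q = pi * real q"
  have "real q \<le> \<gamma> * \<rho> / pi" "\<gamma> * \<rho> / pi < real q + 1"
    using \<gamma> \<rho> unfolding q_def by (auto simp: of_nat_floor) 
  then have Q: "Q \<le> \<gamma> * \<rho>" "\<gamma> * \<rho> < Q + pi" by (auto simp: Q_def field_simps)
  have "P < Q" using Q big pi_gt_zero by linarith
  then have pq: "p < q" by (simp add: P_def Q_def)
  have Q2: "\<gamma> * \<rho> / 2 \<le> Q" using Q big P pi_gt_zero by linarith
  obtain F F' y y' where F: "\<And>x. (F has_real_derivative F' x) (at x)" "continuous_on UNIV F'"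
      "\<And>x. x \<notin> {P<..<Q} \<Longrightarrow> F x = 1 \<and> F' x = 0"
      "\<And>x. \<bar>F x - 1\<bar> \<le> 7 * K / P" "\<And>x. 0 < x \<Longrightarrow> \<bar>F' x\<bar> \<le> 30 * K / x"
    and y: "y 0 = 0" "y' 0 = 1"
      "\<And>x. 0 \<le> x \<Longrightarrow> (y has_real_derivative y' x) (at x)"
      "\<And>x. 0 \<le> x \<Longrightarrow> (y' has_real_derivative - (F x * y x)) (at x)"
      "\<And>x. Q \<le> x \<Longrightarrow> exp (K * (ln (Q / P) - 3)) \<le> (y x)\<^sup>2 + (y' x)\<^sup>2"
    using resonant_profile[OF K P(2)[unfolded P_def] pq] unfolding P_def[symmetric] Q_def[symmetric] by metis
  have "\<exists>c2\<in>PS1 T0 \<mu>1 \<mu>2 \<omega>. dist_PS1 T0 \<mu>1 \<mu>2 \<omega> c c2 < \<epsilon> \<and> (\<forall>t\<in>{0..\<rho>}. c2 t = c0 * F (\<gamma> * t))"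
    using F(3) F(4) by (intro pert[OF F(1,2) _ _ F(5) \<gamma>(1) Q(1)]) (auto simp: P_def)
  then obtain c2 where c2: "c2 \<in> PS1 T0 \<mu>1 \<mu>2 \<omega>" "dist_PS1 T0 \<mu>1 \<mu>2 \<omega> c c2 < \<epsilon>"
    "\<And>t. t \<in> {0..\<rho>} \<Longrightarrow> c2 t = c0 * F (\<gamma> * t)" by blast
  have c2cont: "continuous_on {0..T0} c2" using c2(1) by (simp add: PS1_def)
  obtain w v where wv: "wave_mode T0 c2 lam w v"
    using wave_mode_exists[OF T0 c2cont] by blast
  have ex: "wave_mode \<rho> c2 lam (\<lambda>t. y (\<gamma> * t) / \<gamma>) (\<lambda>t. y' (\<gamma> * t))"
    unfolding wave_mode_def
  proof (intro conjI ballI)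
    fix t assume t: "t \<in> {0..\<rho>}"
    then have "0 \<le> \<gamma> * t" using \<gamma> by simp
    note d = y(3)[OF this] y(4)[OF this]
    have dl: "((\<lambda>t. \<gamma> * t) has_real_derivative \<gamma>) (at t)" by (auto intro!: derivative_eq_intros)
    have "((\<lambda>t. y (\<gamma> * t) / \<gamma>) has_real_derivative y' (\<gamma> * t) * \<gamma> / \<gamma>) (at t)"
      by (intro DERIV_cdivide DERIV_chain2[OF d(1) dl])
    then show "((\<lambda>t. y (\<gamma> * t) / \<gamma>) has_real_derivative y' (\<gamma> * t)) (at t within {0..\<rho>})"
      using \<gamma> by (auto intro: has_field_derivative_at_within)
    have "((\<lambda>t. y' (\<gamma> * t)) has_real_derivative - (F (\<gamma> * t) * y (\<gamma> * t)) * \<gamma>) (at t)"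
      by (rule DERIV_chain2[OF d(2) dl])
    moreover have "- (F (\<gamma> * t) * y (\<gamma> * t)) * \<gamma> = - (c2 t * lam * (y (\<gamma> * t) / \<gamma>))"
    proof -
      have "c2 t * lam = F (\<gamma> * t) * \<gamma>\<^sup>2" using c2(3)[OF t] \<gamma>(2) by simp
      then show ?thesis using \<gamma>(1) by (simp add: power2_eq_square)
    qed
    ultimately show "((\<lambda>t. y' (\<gamma> * t)) has_real_derivative - (c2 t * lam * (y (\<gamma> * t) / \<gamma>))) (at t within {0..\<rho>})"
      by (simp add: has_field_derivative_at_within)
  qed (use y in auto)
  have at_\<rho>: "w \<rho> = y (\<gamma> * \<rho>) / \<gamma>" "v \<rho> = y' (\<gamma> * \<rho>)"
    using wave_mode_unique[OF wave_mode_initial_segment[OF wv] ex \<rho>(1) lam0(1), of \<rho>] \<rho>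
      continuous_on_subset[OF c2cont, of "{0..\<rho>}"] by auto
  have c2\<rho>: "c2 \<rho> = c0" using c2(3)[of \<rho>] \<rho> F(3)[of "\<gamma> * \<rho>"] Q by auto
  have start: "exp (K * (ln (Q / P) - 3)) \<le> (v \<rho>)\<^sup>2 + lam * c2 \<rho> * (w \<rho>)\<^sup>2"
  proof -
    have "lam * c2 \<rho> * (w \<rho>)\<^sup>2 = (y (\<gamma> * \<rho>))\<^sup>2"
      unfolding c2\<rho> at_\<rho> \<gamma>(2)[symmetric] using \<gamma>(1) by (simp add: power_divide)
    then show ?thesis using y(5)[OF Q(1)] at_\<rho> by simp
  qed
  have grow: "(1 + \<mu>2) * lam ^ (4 * m) < exp (K * (ln (Q / P) - 3)) * exp (- (L / \<mu>1) * T0)"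
  proof -
    have "B * sqrt lam \<le> Q / P"
      using Q2 P by (simp add: B_def \<gamma>_def field_simps)
    then have "ln (B * sqrt lam) \<le> ln (Q / P)" using B lam0 by (intro ln_mono) auto
    then have "exp (K * ln (B * sqrt lam) - 3 * K) \<le> exp (K * (ln (Q / P) - 3))"
      using K by (simp add: algebra_simps)
    moreover have "exp (K * ln (B * sqrt lam) - 3 * K) = (B * sqrt lam) ^ N * exp (- 3 * K)"
      using B lam0 exp_of_nat_mult[of N "ln (B * sqrt lam)"] by (simp add: exp_diff exp_minus K_def divide_inverse)
    moreover have "(B * sqrt lam) ^ N = B ^ N * (lam ^ (4 * m) * lam)"
    proof -
      have "sqrt lam ^ N = (sqrt lam ^ 2) ^ (4 * m + 1)"
        unfolding N_def power_mult[symmetric] by simp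
      then show ?thesis using lam0 by (simp add: power_mult_distrib)
    qed
    ultimately have "B ^ N * (lam ^ (4 * m) * lam) * exp (- 3 * K) \<le> exp (K * (ln (Q / P) - 3))" by simp
    then have "B ^ N * (lam ^ (4 * m) * lam) * exp (- 3 * K) * exp (- (L / \<mu>1) * T0)
        \<le> exp (K * (ln (Q / P) - 3)) * exp (- (L / \<mu>1) * T0)"
      by (rule mult_right_mono) simp
    moreover have "B ^ N * (lam ^ (4 * m) * lam) * exp (- 3 * K) * exp (- (L / \<mu>1) * T0) = (Z * lam) * lam ^ (4 * m)"
      by (simp add: Z_def)
    moreover have "(1 + \<mu>2) * lam ^ (4 * m) < (Z * lam) * lam ^ (4 * m)"
      using lam(3) Z lam0 by (intro mult_strict_right_mono) (auto simp: field_simps)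
    ultimately show ?thesis by linarith
  qed
  have "lam ^ (4 * m) < (v t)\<^sup>2 + lam * (w t)\<^sup>2" if t: "t \<in> {1 / (real m + 1)..T0}" for t
  proof -
    have t': "\<rho> \<le> t" "t \<le> T0" using t \<rho> by auto
    have "((v \<rho>)\<^sup>2 + lam * c2 \<rho> * (w \<rho>)\<^sup>2) * exp (- (L / \<mu>1) * (t - \<rho>)) \<le> (v t)\<^sup>2 + lam * c2 t * (w t)\<^sup>2"
    proof (rule energy_lower_bound[OF wv lam0(1) \<rho>(1) t'])
      show "continuous_on {\<rho>..T0} c2" using c2cont by (rule continuous_on_subset) (use \<rho> in auto)
      show "0 < \<mu>1" by (rule \<mu>)
      fix s assume s: "\<rho> < s" "s < T0"
      then have s': "s \<in> {0<..<T0}" using \<rho> by auto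
      show "\<mu>1 \<le> c2 s" using c2(1) s' by (simp add: PS1_def)
      have "(c2 has_real_derivative speed_deriv T0 c2 s) (at s within {0<..<T0})"
        by (rule DERIV_subset[OF has_real_derivative_speed_deriv[OF c2(1)]]) (use s' in auto)
      then show "(c2 has_real_derivative speed_deriv T0 c2 s) (at s)"
        using s' by (simp add: at_within_open[of s "{0<..<T0}"])
      have "\<bar>speed_deriv T0 c2 s\<bar> \<le> \<omega> s / s" using c2(1) s' by (simp add: PS1_def)
      also have "\<dots> \<le> L"
        unfolding L_def using anti s \<rho> \<omega>[of \<rho>] by (intro frac_le) (auto simp: monotone_on_def)
      finally show "\<bar>speed_deriv T0 c2 s\<bar> \<le> L" .
    qed
    moreover have "exp (K * (ln (Q / P) - 3)) * exp (- (L / \<mu>1) * T0)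
        \<le> ((v \<rho>)\<^sup>2 + lam * c2 \<rho> * (w \<rho>)\<^sup>2) * exp (- (L / \<mu>1) * (t - \<rho>))"
    proof (rule mult_mono[OF start])
      have "L / \<mu>1 * (t - \<rho>) \<le> L / \<mu>1 * T0" using L \<mu> \<rho> t' by (intro mult_left_mono) auto
      then show "exp (- (L / \<mu>1) * T0) \<le> exp (- (L / \<mu>1) * (t - \<rho>))" by simp
      show "0 \<le> (v \<rho>)\<^sup>2 + lam * c2 \<rho> * (w \<rho>)\<^sup>2" using c2\<rho> c0pos lam0 by simp
    qed simp
    moreover have "(v t)\<^sup>2 + lam * c2 t * (w t)\<^sup>2 \<le> (1 + \<mu>2) * ((v t)\<^sup>2 + lam * (w t)\<^sup>2)"
    proof -
      have "c2 t \<le> 1 + \<mu>2" "1 \<le> 1 + \<mu>2" using PS1_bounds[OF c2(1) T0, of t] t' \<rho> \<mu> by auto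
      then have "c2 t * (lam * (w t)\<^sup>2) \<le> (1 + \<mu>2) * (lam * (w t)\<^sup>2)" "1 * (v t)\<^sup>2 \<le> (1 + \<mu>2) * (v t)\<^sup>2"
        using lam0 by (intro mult_right_mono; simp)+
      then show ?thesis by (simp add: algebra_simps)
    qed
    ultimately have "(1 + \<mu>2) * lam ^ (4 * m) < (1 + \<mu>2) * ((v t)\<^sup>2 + lam * (w t)\<^sup>2)"
      using grow by linarith
    then show ?thesis using \<mu> by simp
  qed
  then have "amplifying T0 l m c2"
    unfolding amplifying_def using wv lam(1) lam_def by blast
  then show ?thesis using c2 by blast
qed

text \<open>
  Amplification involves one frequency only, and the energy exceeds its threshold by a positive
  gap on the compact interval. At a fixed frequency the mode depends continuously on the speed.
\<close>

lemma open_amplifying: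
  assumes c: "c \<in> PS1 T0 \<mu>1 \<mu>2 \<omega>" and T0: "0 < T0" and \<mu>: "0 < \<mu>1"
    and \<omega>: "\<And>t. t \<in> {0<..T0} \<Longrightarrow> 0 < \<omega> t" and amp: "amplifying T0 l m c"
  shows "\<exists>\<delta>>0. \<forall>c2\<in>PS1 T0 \<mu>1 \<mu>2 \<omega>. dist_PS1 T0 \<mu>1 \<mu>2 \<omega> c c2 < \<delta> \<longrightarrow> amplifying T0 l m c2"
proof -
  obtain n w v where n: "real m + 2 < l n" and wv: "wave_mode T0 c (l n) w v"
    and E: "\<And>t. t \<in> {1 / (real m + 1)..T0} \<Longrightarrow> l n ^ (4 * m) < (v t)\<^sup>2 + l n * (w t)\<^sup>2"
    using amp unfolding amplifying_def by blast
  define lam where "lam = l n"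
  have lam: "0 < lam" using n by (simp add: lam_def)
  note wv = wv[folded lam_def] and E = E[folded lam_def]
  note cont = wave_mode_continuous[OF wv]
  have sub: "{1 / (real m + 1)..T0} \<subseteq> {0..T0}" by auto
  have "bounded (w ` {0..T0})" "bounded (v ` {0..T0})"
    by (intro compact_imp_bounded compact_continuous_image cont; simp)+
  then obtain W V where "\<forall>y\<in>w ` {0..T0}. norm y \<le> W" "\<forall>y\<in>v ` {0..T0}. norm y \<le> V"
    unfolding bounded_iff by blast
  then have W: "\<And>t. t \<in> {0..T0} \<Longrightarrow> \<bar>w t\<bar> \<le> W" and V: "\<And>t. t \<in> {0..T0} \<Longrightarrow> \<bar>v t\<bar> \<le> V" by auto
  have WV: "0 \<le> W" "0 \<le> V" using W[of 0] V[of 0] T0 by auto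
  obtain gap where gap: "gap > 0" "\<And>t. t \<in> {1 / (real m + 1)..T0} \<Longrightarrow> lam ^ (4 * m) + gap \<le> (v t)\<^sup>2 + lam * (w t)\<^sup>2"
  proof (cases "{1 / (real m + 1)..T0} = {}")
    case True
    then show ?thesis using that[of 1] by auto
  next
    case False
    have "continuous_on {1 / (real m + 1)..T0} (\<lambda>t. (v t)\<^sup>2 + lam * (w t)\<^sup>2)"
      by (intro continuous_intros continuous_on_subset[OF cont(1) sub] continuous_on_subset[OF cont(2) sub])
    from continuous_attains_inf[OF _ False this] obtain t0 where t0: "t0 \<in> {1 / (real m + 1)..T0}"
      "\<And>t. t \<in> {1 / (real m + 1)..T0} \<Longrightarrow> (v t0)\<^sup>2 + lam * (w t0)\<^sup>2 \<le> (v t)\<^sup>2 + lam * (w t)\<^sup>2"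
      by auto
    then show ?thesis using E[OF t0(1)] that[of "(v t0)\<^sup>2 + lam * (w t0)\<^sup>2 - lam ^ (4 * m)"] by force
  qed
  define R where "R = lam * W * sqrt (T0 * exp ((2 + lam * \<mu>2) * T0))"
  define H where "H = 2 * V + 2 * lam * W"
  have R: "0 \<le> R" and H: "0 \<le> H" using lam WV T0 by (auto simp: R_def H_def)
  define \<delta> where "\<delta> = gap / ((R + 1) * (H + 1))"
  have \<delta>: "0 < \<delta>" using gap R H by (simp add: \<delta>_def)
  have \<delta>RH: "\<delta> * R * H < gap"
  proof -
    have "R * H < (R + 1) * (H + 1)" using R H by (simp add: algebra_simps)
    then have "\<delta> * (R * H) < \<delta> * ((R + 1) * (H + 1))" using \<delta> by (rule mult_strict_left_mono)
    also have "\<dots> = gap" using R H by (simp add: \<delta>_def)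
    finally show ?thesis by simp
  qed
  show ?thesis
  proof (intro exI[of _ \<delta>] conjI ballI impI)
    fix c2 assume c2: "c2 \<in> PS1 T0 \<mu>1 \<mu>2 \<omega>" and close: "dist_PS1 T0 \<mu>1 \<mu>2 \<omega> c c2 < \<delta>"
    have "continuous_on {0..T0} c2" using c2 by (simp add: PS1_def)
    from wave_mode_exists[OF T0 this] obtain w2 v2 where wv2: "wave_mode T0 c2 lam w2 v2" by blast
    have "lam ^ (4 * m) < (v2 t)\<^sup>2 + lam * (w2 t)\<^sup>2" if t: "t \<in> {1 / (real m + 1)..T0}" for t
    proof -
      have t': "t \<in> {0..T0}" using t sub by blast
      have "(w2 t - w t)\<^sup>2 + (v2 t - v t)\<^sup>2 \<le> (lam * \<delta> * W)\<^sup>2 * T0 * exp ((2 + lam * \<mu>2) * T0)"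
      proof (rule wave_mode_stability[OF wv2 wv T0 lam t'])
        fix s assume s: "0 < s" "s < T0"
        show "\<bar>c2 s\<bar> \<le> \<mu>2" using PS1_bounds[OF c2 T0, of s] s \<mu> by auto
        have "\<bar>c s - c2 s\<bar> \<le> dist_PS1 T0 \<mu>1 \<mu>2 \<omega> c c2"
          by (rule abs_diff_le_dist_PS1[OF c c2 _ \<omega>]) (use s in auto)
        then show "\<bar>c2 s - c s\<bar> \<le> \<delta>" using close by linarith
        show "\<bar>w s\<bar> \<le> W" using W s by simp
      qed
      also have "\<dots> = (\<delta> * R)\<^sup>2" using T0 by (simp add: R_def power_mult_distrib)
      finally have d: "(w2 t - w t)\<^sup>2 + (v2 t - v t)\<^sup>2 \<le> (\<delta> * R)\<^sup>2" .
      then have "(w2 t - w t)\<^sup>2 \<le> (\<delta> * R)\<^sup>2" "(v2 t - v t)\<^sup>2 \<le> (\<delta> * R)\<^sup>2"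
        using zero_le_power2[of "w2 t - w t"] zero_le_power2[of "v2 t - v t"] by linarith+
      then have dw: "\<bar>w2 t - w t\<bar> \<le> \<delta> * R" and dv: "\<bar>v2 t - v t\<bar> \<le> \<delta> * R"
        using \<delta> R by (auto simp: abs_le_square_iff[symmetric])
      have sq: "b\<^sup>2 - 2 * B * D \<le> a\<^sup>2" if "\<bar>a - b\<bar> \<le> D" "\<bar>b\<bar> \<le> B" for a b B D :: real
      proof -
        have "a\<^sup>2 = b\<^sup>2 + 2 * b * (a - b) + (a - b)\<^sup>2" by (simp add: power2_eq_square algebra_simps)
        moreover have "\<bar>b * (a - b)\<bar> \<le> B * D"
          unfolding abs_mult using that by (intro mult_mono) auto
        ultimately show ?thesis using zero_le_power2[of "a - b"] by linarith
      qed
      have "(v t)\<^sup>2 - 2 * V * (\<delta> * R) \<le> (v2 t)\<^sup>2" by (rule sq[OF dv V[OF t']])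
      moreover have "lam * ((w t)\<^sup>2 - 2 * W * (\<delta> * R)) \<le> lam * (w2 t)\<^sup>2"
        using lam by (intro mult_left_mono sq[OF dw W[OF t']]) auto
      moreover have "2 * V * (\<delta> * R) + lam * (2 * W * (\<delta> * R)) = \<delta> * R * H"
        by (simp add: H_def algebra_simps)
      ultimately show ?thesis using gap(2)[OF t] \<delta>RH by (simp add: right_diff_distrib)
    qed
    then show "amplifying T0 l m c2"
      unfolding amplifying_def using wv2 n unfolding lam_def by blast
  qed (rule \<delta>)
qed

section \<open>From amplified modes to infinite derivative loss\<close>

text \<open>
  Applying the hypothesis with a larger \<open>m\<close> yields larger eigenvalues without weakening the
  conclusion, so the eigenvalues can be chosen strictly increasing, hence distinct. Distinctness
  is what separates the supports of the chosen eigenfunctions.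
\<close>

lemma amplified_frequencies:
  fixes l :: "nat \<Rightarrow> real"
  assumes amp: "\<And>m. amplifying T l m c"
  obtains ix :: "nat \<Rightarrow> nat" and w v :: "nat \<Rightarrow> real \<Rightarrow> real"
  where "strict_mono (\<lambda>k. l (ix k))" and "\<And>k. 2 < l (ix k)"
    and "\<And>k. wave_mode T c (l (ix k)) (w k) (v k)"
    and "\<And>k t. t \<in> {1 / (real k + 1)..T} \<Longrightarrow> l (ix k) ^ (4 * k) < (v k t)\<^sup>2 + l (ix k) * (w k t)\<^sup>2"
proof -
  define good where "good k n \<longleftrightarrow> 2 < l n \<and> (\<exists>w v. wave_mode T c (l n) w v \<and>
     (\<forall>t\<in>{1 / (real k + 1)..T}. l n ^ (4 * k) < (v t)\<^sup>2 + l n * (w t)\<^sup>2))" for k n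
  have ex: "\<exists>n. good k n \<and> B < l n" for k B
  proof -
    define m where "m = max k (nat \<lceil>B\<rceil>)"
    obtain n w v where n: "real m + 2 < l n" "wave_mode T c (l n) w v"
      "\<And>t. t \<in> {1 / (real m + 1)..T} \<Longrightarrow> l n ^ (4 * m) < (v t)\<^sup>2 + l n * (w t)\<^sup>2"
      using amp[of m] unfolding amplifying_def by blast
    have "B \<le> real m" "k \<le> m" unfolding m_def by linarith+
    moreover have "l n ^ (4 * k) < (v t)\<^sup>2 + l n * (w t)\<^sup>2" if t: "t \<in> {1 / (real k + 1)..T}" for t
    proof -
      have "1 / (real m + 1) \<le> 1 / (real k + 1)" using \<open>k \<le> m\<close> by (simp add: frac_le)
      moreover have "l n ^ (4 * k) \<le> l n ^ (4 * m)" using n(1) \<open>k \<le> m\<close> by (intro power_increasing) auto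
      ultimately show ?thesis using n(3)[of t] t by auto
    qed
    ultimately have "2 < l n" "B < l n" "\<forall>t\<in>{1 / (real k + 1)..T}. l n ^ (4 * k) < (v t)\<^sup>2 + l n * (w t)\<^sup>2"
      using n(1) by auto
    then show ?thesis using n(2) unfolding good_def by blast
  qed
  obtain ix where ix: "\<And>k. good k (ix k)" "\<And>k. l (ix k) < l (ix (Suc k))"
    using dependent_nat_choice[of good "\<lambda>_ n n'. l n < l n'"] ex by metis
  from ix(1) have "\<exists>wv. wave_mode T c (l (ix k)) (fst wv) (snd wv) \<and>
     (\<forall>t\<in>{1 / (real k + 1)..T}. l (ix k) ^ (4 * k) < (snd wv t)\<^sup>2 + l (ix k) * (fst wv t)\<^sup>2)" for k
    unfolding good_def by fastforce
  then obtain wv where wv: "\<And>k. wave_mode T c (l (ix k)) (fst (wv k)) (snd (wv k)) \<and>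
     (\<forall>t\<in>{1 / (real k + 1)..T}. l (ix k) ^ (4 * k) < (snd (wv k) t)\<^sup>2 + l (ix k) * (fst (wv k) t)\<^sup>2)"
    by metis
  show thesis
  proof (rule that[of ix "\<lambda>k. fst (wv k)" "\<lambda>k. snd (wv k)"])
    show "strict_mono (\<lambda>k. l (ix k))" using ix(2) by (simp add: strict_mono_Suc_iff)
  qed (use wv ix(1) in \<open>auto simp: good_def\<close>)
qed

text \<open>
  Let \<open>lam k\<close> be the amplified eigenvalues, with modes \<open>w k\<close>, \<open>v k\<close> and eigenfunctions \<open>\<psi> k\<close>. The initial
  velocity \<open>f\<close> is \<open>\<psi> k / lam k ^ k\<close> on the level set \<open>a = lam k\<close>, and zero elsewhere. Each squared norm of
  \<open>f\<close> is a sum over \<open>k\<close> whose terms are bounded by \<open>lam k ^ (- k)\<close> from some \<open>k\<close> on. At a time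
  \<open>t > 0\<close>, the part of the solution on a single level set \<open>a = lam k\<close> with \<open>k\<close> large already
  has a squared weighted norm of at least \<open>2 ^ k\<close>.
\<close>

lemma infinite_derivative_loss_if_amplifying:
  fixes M :: "'x measure" and a :: "'x \<Rightarrow> real" and \<phi> :: "nat \<Rightarrow> 'x \<Rightarrow> real" and l :: "nat \<Rightarrow> real"
  assumes a: "a \<in> borel_measurable M"
    and \<phi>: "\<And>n. \<phi> n \<in> L2 M" and norm: "\<And>n. (\<integral>x. (\<phi> n x)\<^sup>2 \<partial>M) = 1"
    and eig: "\<And>n. AE x in M. a x * \<phi> n x = l n * \<phi> n x"
    and amp: "\<And>m. amplifying T l m c"
  shows "infinite_derivative_loss M a T c"
proof -
  obtain ix w v where mono: "strict_mono (\<lambda>k. l (ix k))" and two: "\<And>k. 2 < l (ix k)"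
    and wv: "\<And>k. wave_mode T c (l (ix k)) (w k) (v k)"
    and E: "\<And>k t. t \<in> {1 / (real k + 1)..T} \<Longrightarrow> l (ix k) ^ (4 * k) < (v k t)\<^sup>2 + l (ix k) * (w k t)\<^sup>2"
    using amplified_frequencies[OF amp] by metis
  define lam where "lam k = l (ix k)" for k
  define \<psi> where "\<psi> k = \<phi> (ix k)" for k
  note two = two[folded lam_def] and wv = wv[folded lam_def] and E = E[folded lam_def]
  have inj: "inj lam" using mono strict_mono_imp_inj_on unfolding lam_def[abs_def] by blast
  have \<psi>m: "\<psi> k \<in> borel_measurable M" and \<psi>i: "integrable M (\<lambda>x. (\<psi> k x)\<^sup>2)" for k
    using \<phi>[of "ix k"] by (auto simp: L2_def \<psi>_def)
  have \<psi>norm: "(\<integral>x. (\<psi> k x)\<^sup>2 \<partial>M) = 1" for k using norm by (simp add: \<psi>_def)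
  have \<psi>eig: "AE x in M. a x * \<psi> k x = lam k * \<psi> k x" for k using eig by (simp add: \<psi>_def lam_def)
  have lam_powr: "(1 + lam k) powr (2 * \<beta>) \<le> lam k ^ k" if "0 < \<beta>" "4 * \<beta> \<le> real k" for k \<beta>
  proof -
    have "2 * lam k \<le> lam k * lam k" using two[of k] by (intro mult_right_mono) auto
    then have "1 + lam k \<le> lam k ^ 2" unfolding power2_eq_square using two[of k] by linarith
    then have "(1 + lam k) powr (2 * \<beta>) \<le> (lam k ^ 2) powr (2 * \<beta>)"
      using that two[of k] by (intro powr_mono2) auto
    also have "\<dots> = lam k powr (4 * \<beta>)"
      using two[of k] by (simp add: powr_powr flip: powr_numeral)
    also have "\<dots> \<le> lam k powr real k" using that two[of k] by (intro powr_mono) auto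
    finally show ?thesis using two[of k] by (simp add: powr_realpow)
  qed
  have two_power: "2 ^ k \<le> lam k ^ k" for k using two[of k] by (intro power_mono) auto
  define f where "f x = (\<Sum>k. indicator {lam k} (a x) * (\<psi> k x / lam k ^ k))" for x
  have f_at: "f x = \<psi> j x / lam j ^ j" if "a x = lam j" for x j
    unfolding f_def using injD[OF inj] that
    by (subst suminf_finite[of "{j}"]) (auto simp: indicator_def)
  have f_out: "f x = 0" if "a x \<notin> range lam" for x
    unfolding f_def using that by (subst suminf_finite[of "{}"]) (auto simp: indicator_def)
  have [measurable]: "a \<in> borel_measurable M" "\<And>k. \<psi> k \<in> borel_measurable M" by (fact a \<psi>m)+
  have fm [measurable]: "f \<in> borel_measurable M" unfolding f_def by measurable
  \<comment> \<open>Off the level sets \<open>f\<close> vanishes, and the value of \<open>ind\<close> is irrelevant.\<close>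
  define ind where "ind x = inv lam (a x)" for x
  have ind: "ind x = k" if "a x = lam k" for x k using that inj by (simp add: ind_def)
  define u where "u t x = f x * w (ind x) t" for t x
  define u' where "u' t x = f x * v (ind x) t" for t x
  have u0: "u 0 = (\<lambda>x. 0)" and u'0: "u' 0 = f"
    using wv by (auto simp: u_def u'_def wave_mode_def)
  have sol: "solves_wave_equation M a T c (\<lambda>x. 0) f u u'"
    unfolding solves_wave_equation_def
  proof (intro conjI AE_I2 ballI)
    fix x t assume t: "t \<in> {0..T}"
    have wd: "((\<lambda>s. w k s) has_real_derivative v k t) (at t within {0..T})"
      "((\<lambda>s. v k s) has_real_derivative - (c t * lam k * w k t)) (at t within {0..T})" for k
      using wv[of k] t by (auto simp: wave_mode_def)
    show "((\<lambda>s. u s x) has_real_derivative u' t x) (at t within {0..T})"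
      unfolding u_def u'_def by (rule DERIV_cmult[OF wd(1)])
    have "((\<lambda>s. u' s x) has_real_derivative f x * - (c t * lam (ind x) * w (ind x) t)) (at t within {0..T})"
      unfolding u'_def by (rule DERIV_cmult[OF wd(2)])
    moreover have "f x * - (c t * lam (ind x) * w (ind x) t) = - (c t * a x * u t x)"
    proof (cases "a x \<in> range lam")
      case True
      then have "lam (ind x) = a x" by (simp add: ind_def f_inv_into_f)
      then show ?thesis by (simp add: u_def)
    qed (simp add: f_out u_def)
    ultimately show "((\<lambda>s. u' s x) has_real_derivative - (c t * a x * u t x)) (at t within {0..T})"
      by (simp only:)
  qed (use u0 u'0 fm in auto)
  have zero_dom: "(\<lambda>x. 0) \<in> dom_power M a \<beta>" for \<beta>
    unfolding dom_power_def L2_def by (auto intro!: bexI[of _ "\<lambda>x. 0"])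
  have f_dom: "f \<in> dom_power M a \<beta>" if \<beta>: "0 < \<beta>" for \<beta>
  proof -
    define b where "b k = (1 + lam k) powr (2 * \<beta>) / lam k ^ (2 * k)" for k
    have b0: "0 \<le> b k" for k using two[of k] by (simp add: b_def)
    have "summable b"
    proof (rule summable_comparison_test')
      fix k assume k: "nat \<lceil>4 * \<beta>\<rceil> \<le> k"
      then have "4 * \<beta> \<le> real k" by linarith
      have p: "0 < lam k ^ k" using two[of k] by simp
      have "b k \<le> lam k ^ k / lam k ^ (2 * k)"
        unfolding b_def using lam_powr[OF \<beta> \<open>4 * \<beta> \<le> real k\<close>] two[of k] by (intro divide_right_mono) auto
      also have "\<dots> = 1 / lam k ^ k" using p by (simp add: mult_2 power_add)
      also have "\<dots> \<le> 1 / 2 ^ k" using two_power[of k] p by (intro divide_left_mono) auto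
      finally show "norm (b k) \<le> (1/2) ^ k" using b0[of k] by (simp add: power_one_over)
    qed (rule summable_geometric; simp)
    let ?g = "\<lambda>x. (1 + a x) powr \<beta> * f x"
    have "integrable M (\<lambda>x. (?g x)\<^sup>2)"
    proof (rule integrableI_bounded)
      have "ennreal (norm ((?g x)\<^sup>2)) \<le> (\<Sum>k. ennreal (b k) * ennreal ((\<psi> k x)\<^sup>2))" for x
      proof (cases "a x \<in> range lam")
        case True
        then obtain j where j: "a x = lam j" by blast
        have "norm ((?g x)\<^sup>2) = b j * (\<psi> j x)\<^sup>2"
        proof -
          have "((1 + lam j) powr \<beta>)\<^sup>2 = (1 + lam j) powr (2 * \<beta>)"
            using two[of j] by (simp add: powr_powr mult.commute flip: powr_numeral)
          then show ?thesis
            by (simp add: f_at[OF j] j b_def power_mult_distrib power_divide power_mult mult.commute[of 2])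
        qed
        then have "ennreal (norm ((?g x)\<^sup>2)) = (\<Sum>k\<in>{j}. ennreal (b k) * ennreal ((\<psi> k x)\<^sup>2))"
          using b0 by (simp add: ennreal_mult)
        also have "\<dots> \<le> (\<Sum>k. ennreal (b k) * ennreal ((\<psi> k x)\<^sup>2))"
          by (intro sum_le_suminf) auto
        finally show ?thesis .
      qed (simp add: f_out)
      then have "(\<integral>\<^sup>+x. ennreal (norm ((?g x)\<^sup>2)) \<partial>M) \<le> (\<integral>\<^sup>+x. (\<Sum>k. ennreal (b k) * ennreal ((\<psi> k x)\<^sup>2)) \<partial>M)"
        by (intro nn_integral_mono)
      also have "\<dots> = (\<Sum>k. ennreal (b k) * (\<integral>\<^sup>+x. ennreal ((\<psi> k x)\<^sup>2) \<partial>M))"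
        by (subst nn_integral_suminf) (auto simp: nn_integral_cmult)
      also have "\<dots> = (\<Sum>k. ennreal (b k))"
        using \<psi>i \<psi>norm by (simp add: nn_integral_eq_integral)
      also have "\<dots> < \<infinity>"
        using suminf_ennreal2[OF b0 \<open>summable b\<close>] by simp
      finally show "(\<integral>\<^sup>+x. ennreal (norm ((?g x)\<^sup>2)) \<partial>M) < \<infinity>" .
    qed measurable
    then show ?thesis unfolding dom_power_def L2_def by (auto intro!: bexI[of _ f])
  qed
  have loss: "(u t, u' t) \<notin> dom_power M a (- \<beta> + 1/2) \<times> dom_power M a (- \<beta>)"
    if \<beta>: "0 < \<beta>" and t: "t \<in> {0<..T}" for \<beta> t
  proof
    assume "(u t, u' t) \<in> dom_power M a (- \<beta> + 1/2) \<times> dom_power M a (- \<beta>)"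
    then obtain y z where y: "AE x in M. u t x = y x" "integrable M (\<lambda>x. ((1 + a x) powr (- \<beta> + 1/2) * y x)\<^sup>2)"
      and z: "AE x in M. u' t x = z x" "integrable M (\<lambda>x. ((1 + a x) powr (- \<beta>) * z x)\<^sup>2)"
      unfolding dom_power_def L2_def by auto
    define g where "g x = ((1 + a x) powr (- \<beta> + 1/2) * y x)\<^sup>2 + ((1 + a x) powr (- \<beta>) * z x)\<^sup>2" for x
    have gi: "integrable M g" unfolding g_def using y(2) z(2) by simp
    define I where "I = (\<integral>x. g x \<partial>M)"
    obtain k :: nat where k: "max (4 * \<beta>) (max (1 / t) I) \<le> real k" using real_arch_simple by blast
    have kb: "4 * \<beta> \<le> real k" "1 / t \<le> real k" "I \<le> real k" using k by auto
    have "1 / (real k + 1) \<le> t"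
    proof -
      have "1 \<le> real k * t" using kb(2) t by (simp add: field_simps)
      then show ?thesis using t by (simp add: field_simps)
    qed
    then have Ek: "lam k ^ (4 * k) < (v k t)\<^sup>2 + lam k * (w k t)\<^sup>2" using E t by auto
    have "AE x in M. 2 ^ k * (\<psi> k x)\<^sup>2 \<le> g x"
      using \<psi>eig[of k] y(1) z(1)
    proof eventually_elim
      case (elim x)
      show ?case
      proof (cases "\<psi> k x = 0")
        case False
        then have ax: "a x = lam k" using elim by simp
        let ?L = "1 + lam k"
        have L: "0 < ?L" using two[of k] by simp
        have p: "0 < lam k ^ k" using two[of k] by simp
        have sq1: "(?L powr (- \<beta>))\<^sup>2 = 1 / ?L powr (2 * \<beta>)"
          using L by (simp add: power2_eq_square powr_minus powr_add[symmetric] field_simps)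
        have sq2: "(?L powr (- \<beta> + 1/2))\<^sup>2 = ?L / ?L powr (2 * \<beta>)"
        proof -
          have "(?L powr (- \<beta> + 1/2))\<^sup>2 = (?L powr (- \<beta>))\<^sup>2 * (?L powr (1/2))\<^sup>2"
            by (simp only: powr_add power_mult_distrib)
          also have "(?L powr (1/2))\<^sup>2 = ?L" using L by (simp add: powr_half_sqrt)
          finally show ?thesis unfolding sq1 by simp
        qed
        have "g x = (\<psi> k x)\<^sup>2 * (((v k t)\<^sup>2 + ?L * (w k t)\<^sup>2) / (?L powr (2 * \<beta>) * (lam k ^ k)\<^sup>2))"
          unfolding g_def ax power_mult_distrib sq1 sq2 elim(2)[symmetric] elim(3)[symmetric] u_def u'_def
            f_at[OF ax] ind[OF ax] power_divide
          by (simp add: field_simps add_divide_distrib)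
        moreover have "2 ^ k \<le> ((v k t)\<^sup>2 + ?L * (w k t)\<^sup>2) / (?L powr (2 * \<beta>) * (lam k ^ k)\<^sup>2)"
        proof -
          have "2 ^ k * (?L powr (2 * \<beta>) * (lam k ^ k)\<^sup>2) \<le> lam k ^ k * (lam k ^ k * (lam k ^ k)\<^sup>2)"
            using two_power[of k] lam_powr[OF \<beta> kb(1)] p by (intro mult_mono) auto
          also have "\<dots> = lam k ^ (4 * k)"
            by (simp add: eval_nat_numeral power_add)
          also have "\<dots> \<le> (v k t)\<^sup>2 + ?L * (w k t)\<^sup>2"
            unfolding distrib_right using Ek zero_le_power2[of "w k t"] by linarith
          finally have "2 ^ k * (?L powr (2 * \<beta>) * (lam k ^ k)\<^sup>2) \<le> (v k t)\<^sup>2 + ?L * (w k t)\<^sup>2" .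
          moreover have "0 < ?L powr (2 * \<beta>) * (lam k ^ k)\<^sup>2"
            by (intro mult_pos_pos zero_less_power) (use two[of k] in auto)
          ultimately show ?thesis by (simp only: pos_le_divide_eq)
        qed
        ultimately show ?thesis
          by (simp only: mult.commute[of "2 ^ k"] mult_left_mono zero_le_power2)
      qed (simp add: g_def)
    qed
    then have "(\<integral>x. 2 ^ k * (\<psi> k x)\<^sup>2 \<partial>M) \<le> I"
      unfolding I_def using \<psi>i[of k] gi by (intro integral_mono_AE) auto
    then have "2 ^ k \<le> I" using \<psi>norm[of k] by simp
    moreover have "real k < 2 ^ k" by (rule of_nat_less_two_power)
    ultimately show False using kb(3) by linarith
  qed
  show ?thesis
    unfolding infinite_derivative_loss_def
    using sol zero_dom f_dom loss u0 u'0
    by (intro exI[of _ "\<lambda>x. 0"] exI[of _ f] exI[of _ u] exI[of _ u']) auto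
qed

theorem theorem2p9:
  fixes D :: "'h::{real_inner, complete_space} set" and A :: "'h \<Rightarrow> 'h"
    and M :: "'x measure" and a :: "'x \<Rightarrow> real" and U :: "'h \<Rightarrow> 'x \<Rightarrow> real"
    and T0 \<mu>1 \<mu>2 :: real and \<omega> :: "real \<Rightarrow> real"
  assumes "self_adjoint D A" and "nonnegative_operator D A"
    and "unbounded_positive_multiplication_operator D A"
    and "spectral_representation D A M a U"
    and "0 < T0" and "0 < \<mu>1" and "\<mu>1 < \<mu>2"
    and "\<And>t. t \<in> {0<..T0} \<Longrightarrow> 0 < \<omega> t"
    and "antimono_on {0<..T0} \<omega>"
    and "filterlim \<omega> at_top (at_right 0)"
  shows "residual_in (Metric_space.mtopology (PS1 T0 \<mu>1 \<mu>2 \<omega>) (dist_PS1 T0 \<mu>1 \<mu>2 \<omega>))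
           {c \<in> PS1 T0 \<mu>1 \<mu>2 \<omega>. infinite_derivative_loss M a T0 c}"
proof -
  note T0 = assms(5) and \<mu> = assms(6,7) and \<omega> = assms(8-10)
  obtain e :: "nat \<Rightarrow> 'h" and l :: "nat \<Rightarrow> real"
    where orth: "\<forall>m n. e m \<bullet> e n = (if m = n then 1 else 0)"
      and unb: "\<not> bdd_above (range l)" and eig: "\<forall>n. e n \<in> D \<and> A (e n) = l n *\<^sub>R e n"
    using assms(3) unfolding unbounded_positive_multiplication_operator_def
    by (elim exE conjE) (rule that; assumption)
  have sr: "a \<in> borel_measurable M" "\<And>h. U h \<in> L2 M" "\<And>r h. AE x in M. U (r *\<^sub>R h) x = r * U h x"
    "\<And>h. (\<integral>x. (U h x)\<^sup>2 \<partial>M) = (norm h)\<^sup>2" "\<And>h. h \<in> D \<Longrightarrow> AE x in M. U (A h) x = a x * U h x"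
    using assms(4) unfolding spectral_representation_def by blast+
  have norm1: "(\<integral>x. (U (e n) x)\<^sup>2 \<partial>M) = 1" for n using orth by (simp add: sr(4) power2_norm_eq_inner)
  have eigU: "AE x in M. a x * U (e n) x = l n * U (e n) x" for n
    using sr(5)[of "e n"] sr(3)[of "l n" "e n"] eig by (auto elim: AE_mp)
  interpret PS: Metric_space "PS1 T0 \<mu>1 \<mu>2 \<omega>" "dist_PS1 T0 \<mu>1 \<mu>2 \<omega>"
    by (rule Metric_space_PS1[OF T0 \<omega>(1)])
  let ?P = "PS1 T0 \<mu>1 \<mu>2 \<omega>"
  define N where "N m = {c \<in> ?P. \<not> amplifying T0 l m c}" for m
  have "closedin PS.mtopology (N m)" for m
  proof -
    have "openin PS.mtopology {c \<in> ?P. amplifying T0 l m c}"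
      unfolding PS.openin_mtopology
    proof (intro conjI allI impI)
      fix c assume c: "c \<in> {c \<in> ?P. amplifying T0 l m c}"
      then obtain \<delta> where "\<delta> > 0" "\<forall>c2\<in>?P. dist_PS1 T0 \<mu>1 \<mu>2 \<omega> c c2 < \<delta> \<longrightarrow> amplifying T0 l m c2"
        using open_amplifying[of c T0 \<mu>1 \<mu>2 \<omega> l m] T0 \<mu>(1) \<omega>(1) by blast
      then show "\<exists>r>0. PS.mball c r \<subseteq> {c \<in> ?P. amplifying T0 l m c}"
        by (intro exI[of _ \<delta>]) (auto simp: PS.in_mball)
    qed auto
    moreover have "?P - N m = {c \<in> ?P. amplifying T0 l m c}" by (auto simp: N_def)
    ultimately show ?thesis by (simp add: closedin_def N_def)
  qed
  moreover have "PS.mtopology interior_of (N m) = {}" for m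
  proof (rule ccontr)
    assume "PS.mtopology interior_of (N m) \<noteq> {}"
    then obtain c where c: "c \<in> PS.mtopology interior_of (N m)" by blast
    have "openin PS.mtopology (PS.mtopology interior_of (N m))" by simp
    then obtain r where r: "r > 0" "PS.mball c r \<subseteq> PS.mtopology interior_of (N m)"
      using c unfolding PS.openin_mtopology by blast
    have cP: "c \<in> ?P" using c interior_of_subset[of PS.mtopology "N m"] by (auto simp: N_def)
    obtain c2 where c2: "c2 \<in> ?P" "dist_PS1 T0 \<mu>1 \<mu>2 \<omega> c c2 < r" "amplifying T0 l m c2"
      using dense_amplifying[OF cP T0 \<mu> \<omega> unb r(1)] by blast
    then have "c2 \<in> PS.mball c r" using cP by (simp add: PS.in_mball)
    then have "c2 \<in> N m" using r(2) interior_of_subset[of PS.mtopology "N m"] by blast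
    then show False using c2(3) by (simp add: N_def)
  qed
  moreover have "?P - {c \<in> ?P. infinite_derivative_loss M a T0 c} \<subseteq> \<Union> (range N)"
  proof
    fix c assume c: "c \<in> ?P - {c \<in> ?P. infinite_derivative_loss M a T0 c}"
    then have "\<exists>m. \<not> amplifying T0 l m c"
      using infinite_derivative_loss_if_amplifying[where \<phi> = "\<lambda>n. U (e n)", OF sr(1,2) norm1 eigU] by blast
    then show "c \<in> \<Union> (range N)" using c by (auto simp: N_def)
  qed
  ultimately show ?thesis
    unfolding residual_in_def by (intro conjI exI[of _ "range N"]) auto
qed

end
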